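(* There is a universal constant $C$ such that the following holds. Let $n\ge1$, let $\theta_1,\dots,\theta_n$ be positive real numbers, let $\sigma_n\sim\mathrm{Luce}(\theta_1,\dots,\theta_n)$, and let $\mathrm{occ}(21,\sigma_n)$ be the number of inversions of $\sigma_n$. Then $$\mathbb E(\mathrm{occ}(21,\sigma_n))=\sum_{1\le i<j\le n}\frac{\theta_j}{\theta_i+\theta_j}$$ and $$\mathrm{Var}(\mathrm{occ}(21,\sigma_n))=\sum_{1\le i<j\le n}\frac{\theta_i\theta_j}{(\theta_i+\theta_j)^2}+\sum_{1\le i<j<k\le n}\frac{4\theta_i\theta_j^2\theta_k}{(\theta_i+\theta_j+\theta_k)(\theta_i+\theta_j)(\theta_i+\theta_k)(\theta_j+\theta_k)}.$$ Lastly, let $a:=\left(\sqrt{\mathrm{Var}(\mathrm{occ}(21,\sigma_n))}-n\right)^+$, where $x^+$ denotes the positive part of $x$. Then $$\sup_{t\in\mathbb R}\left|\mathbb P\left(\frac{\mathrm{occ}(21,\sigma_n)-\mathbb E(\mathrm{occ}(21,\sigma_n))}{\sqrt{\mathrm{Var}(\mathrm{occ}(21,\sigma_n))}}\le t\right)-\Phi(t)\right|\le\frac{Cn^4}{a^3}+\frac{Cn}{a}+\frac{Cn^{2/3}}{a^{2/3}},$$ where $\Phi$ is the cumulative distribution function of the standard normal distribution (the right-hand side is interpreted as $+\infty$, i.e. the bound is vacuous, when $a=0$).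
   Context: For positive reals $x_1,\dots,x_n$ with $w=x_1+\dots+x_n$, $$p(x_1,\dots,x_n):=\frac{x_1}{w}\cdot\frac{x_2}{w-x_1}\cdot\frac{x_3}{w-x_1-x_2}\cdots\frac{x_n}{x_n}.$$ A random permutation $\sigma_n$ of $[n]=\{1,\dots,n\}$ is $\mathrm{Luce}(\theta_1,\dots,\theta_n)$-distributed if $\mathbb P(\sigma_n=\sigma)=p(\theta_{\sigma^{-1}(1)},\dots,\theta_{\sigma^{-1}(n)})$ for every permutation $\sigma$ of $[n]$. The number of inversions is $\mathrm{occ}(21,\sigma):=\#\{(i,j):1\le i<j\le n,\ \sigma(i)>\sigma(j)\}$. *)

theory Defs
  imports "HOL-Probability.Probability" "HOL-Combinatorics.Permutations"
begin

definition luce_weight :: "nat \<Rightarrow> (nat \<Rightarrow> real) \<Rightarrow> real" where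
  "luce_weight n x =
     (\<Prod>i=1..n. x i / ((\<Sum>j=1..n. x j) - (\<Sum>j\<in>{1..<i}. x j)))"

(* A random permutation is represented by its law, a pmf on nat => nat.  This keeps the
   sample-space type fixed, so a constant quantified outside the law cannot depend on it.
   Permutations in the sense of "permutes" fix every point outside {1..n}, hence they are
   bijections of nat and inv is the inverse permutation. *)
definition luce_distributed :: "nat \<Rightarrow> (nat \<Rightarrow> real) \<Rightarrow> (nat \<Rightarrow> nat) pmf \<Rightarrow> bool" where
  "luce_distributed n \<theta> P \<longleftrightarrow>
     set_pmf P \<subseteq> {\<sigma>. \<sigma> permutes {1..n}} \<and>
     (\<forall>\<sigma>. \<sigma> permutes {1..n} \<longrightarrow> pmf P \<sigma> = luce_weight n (\<lambda>i. \<theta> (inv \<sigma> i)))"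

definition occ21 :: "nat \<Rightarrow> (nat \<Rightarrow> nat) \<Rightarrow> nat" where
  "occ21 n \<sigma> = card {(i, j). 1 \<le> i \<and> i < j \<and> j \<le> n \<and> \<sigma> i > \<sigma> j}"

end

theory Submission
  imports Defs
begin

text \<open>
  Let \<open>X\<^sub>1, \<dots>, X\<^sub>n\<close> be independent exponential clocks with rates \<open>\<theta>\<^sub>1, \<dots>, \<theta>\<^sub>n\<close>. By memorylessness the
  order in which the clocks ring has the Luce distribution (\<open>nn_integral_race\<close>), so \<open>occ(21, \<sigma>)\<close> has
  the law of \<open>N = \<Sum>\<^sub>i\<^sub><\<^sub>j 1(X\<^sub>j < X\<^sub>i)\<close> (\<open>luce_inversions_law\<close>), a U-statistic of independent variables.

  Each indicator has a Hoeffding decomposition \<open>1(X\<^sub>j < X\<^sub>i) = p\<^sub>i\<^sub>j - d\<^sub>i\<^sub>j(X\<^sub>i) + d\<^sub>j\<^sub>i(X\<^sub>j) + r\<^sub>i\<^sub>j\<close>, in which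
  \<open>d\<^sub>i\<^sub>j\<close> is centred and \<open>r\<^sub>i\<^sub>j\<close> has mean zero in \<open>X\<^sub>i\<close> for fixed \<open>X\<^sub>j\<close> and vice versa. Everything here is
  explicit: \<open>d\<^sub>i\<^sub>j(x) = exp(- \<theta>\<^sub>j x) - \<theta>\<^sub>i / (\<theta>\<^sub>i + \<theta>\<^sub>j)\<close>. Remainders of different pairs are orthogonal to
  each other and to all functions of a single clock. The mean of \<open>N\<close> is therefore \<open>\<Sum> p\<^sub>i\<^sub>j\<close>, and the
  variance is the sum of the variances of the indicators plus the covariances of the \<open>d\<^sub>i\<^sub>j(X\<^sub>i)\<close> and
  \<open>d\<^sub>i\<^sub>k(X\<^sub>i)\<close>, which come from the Laplace transform of the exponential law. In a triple \<open>i < j < k\<close> the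
  shared clocks \<open>i\<close>, \<open>j\<close>, \<open>k\<close> contribute with signs \<open>+\<close>, \<open>-\<close>, \<open>+\<close>, and the three fractions add up to the
  stated one (\<open>variance_clock_inversions\<close>).

  For the normal approximation write \<open>N - \<bbbE>N = S + R\<close>, where \<open>S\<close> collects the functions of single
  clocks and \<open>R\<close> the remainders. Then \<open>S\<close> is a sum of \<open>n\<close> independent centred variables bounded by \<open>n\<close>,
  and \<open>\<bbbE>R\<^sup>2 \<le> n\<^sup>2\<close>. Let \<open>s\<close> be the standard deviation of \<open>N\<close>. A Berry--Esseen bound for
  bounded summands (\<open>Berry_Esseen_bounded\<close>), proved by Stein's method, shows for \<open>s \<ge> 2 n\<close> that \<open>S / s\<close>
  is within \<open>O(n / s)\<close> of the normal law. By Chebyshev's inequality \<open>|R| / s\<close> exceeds \<open>\<epsilon>\<close> with probability at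
  most \<open>(n / (s \<epsilon>))\<^sup>2\<close>, and \<open>\<epsilon> = (n / s)\<^bsup>2/3\<^esup>\<close> balances the two errors. Thus the distance is
  \<open>O((n / s)\<^bsup>2/3\<^esup>)\<close> in this range, which the last term of the claim dominates because \<open>a \<le> s\<close>.
  When \<open>s < 2 n\<close>, the term \<open>n / a\<close> exceeds \<open>1\<close>.
\<close>

section \<open>The standard normal distribution function\<close>

abbreviation Phi :: "real \<Rightarrow> real" where
  "Phi \<equiv> cdf std_normal_distribution"

interpretation std_normal: real_distribution std_normal_distribution
  by (rule real_dist_normal_dist)

lemma Phi_nonneg: "0 \<le> Phi x" and Phi_le_1: "Phi x \<le> 1"
  by (auto simp: cdf_def)

lemma std_normal_density_bounds:
  "0 < std_normal_density x" "std_normal_density x \<le> 1"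
proof -
  show "0 < std_normal_density x"
    by (simp add: normal_density_pos)
  have "1 \<le> sqrt (2 * pi)"
    using pi_gt3 by simp
  then show "std_normal_density x \<le> 1"
    by (simp add: std_normal_density_def divide_le_eq order_trans[OF _ \<open>1 \<le> sqrt (2 * pi)\<close>])
qed

lemma DERIV_std_normal_density:
  "(std_normal_density has_real_derivative (- x * std_normal_density x)) (at x)"
proof -
  have "((\<lambda>x. c * exp (- x\<^sup>2 / 2)) has_real_derivative (- x * (c * exp (- x\<^sup>2 / 2)))) (at x)" for c
    by (auto intro!: derivative_eq_intros)
  then show ?thesis
    unfolding std_normal_density_def .
qed

lemma continuous_std_normal_density: "continuous_on A std_normal_density"
  by (intro continuous_at_imp_continuous_on ballI DERIV_isCont[OF DERIV_std_normal_density])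

lemma DERIV_Phi: "(Phi has_real_derivative std_normal_density x) (at x)"
proof -
  let ?a = "x - 1" and ?b = "x + 1"
  have meas: "Phi y - Phi ?a = integral {?a..y} std_normal_density" if "?a < y" for y
  proof -
    have int: "set_integrable lborel {?a..y} std_normal_density"
      unfolding set_integrable_def
      by (intro borel_integrable_compact) (auto simp: continuous_std_normal_density)
    have "Phi y - Phi ?a = measure std_normal_distribution {?a<..y}"
      using that by (simp add: std_normal.cdf_diff_eq)
    also have "\<dots> = (LINT z|std_normal_distribution. indicator {?a<..y} z)"
      by simp
    also have "\<dots> = (LINT z|lborel. std_normal_density z * indicator {?a<..y} z)"
      by (subst integral_real_density) auto
    also have "\<dots> = (LINT z:{?a..y}|lborel. std_normal_density z)"
      unfolding set_lebesgue_integral_def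
      by (rule integral_cong_AE)
         (use AE_lborel_singleton[of ?a] in \<open>auto elim!: eventually_mono split: split_indicator\<close>)
    also have "\<dots> = integral {?a..y} std_normal_density"
      by (rule set_borel_integral_eq_integral(2)[OF int])
    finally show ?thesis .
  qed
  have "((\<lambda>y. Phi ?a + integral {?a..y} std_normal_density) has_real_derivative
      0 + std_normal_density x) (at x within {?a..?b})"
    by (intro DERIV_add DERIV_const integral_has_real_derivative continuous_std_normal_density) auto
  then have "((\<lambda>y. Phi ?a + integral {?a..y} std_normal_density) has_real_derivative
      std_normal_density x) (at x)"
    by (simp add: at_within_Icc_at)
  then show ?thesis
  proof (rule has_field_derivative_transform_within_open[where S = "{?a<..<?b}"])
    show "Phi ?a + integral {?a..y} std_normal_density = Phi y" if "y \<in> {?a<..<?b}" for y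
      using meas[of y] that by auto
  qed auto
qed

lemma isCont_Phi: "isCont Phi x"
  using DERIV_Phi DERIV_isCont by blast

lemma Phi_Lipschitz: "x \<le> y \<Longrightarrow> Phi y - Phi x \<le> y - x"
proof -
  assume "x \<le> y"
  have "Phi y - y \<le> Phi x - x"
  proof (rule DERIV_nonpos_imp_nonincreasing[OF \<open>x \<le> y\<close>])
    fix t
    show "\<exists>l. ((\<lambda>t. Phi t - t) has_real_derivative l) (at t) \<and> l \<le> 0"
      by (rule exI[of _ "std_normal_density t - 1"])
         (auto intro!: derivative_eq_intros DERIV_Phi simp: std_normal_density_bounds(2))
  qed
  then show ?thesis by simp
qed

lemma std_normal_density_tendsto_0:
  "(std_normal_density \<longlongrightarrow> 0) at_top" "(std_normal_density \<longlongrightarrow> 0) at_bot"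
proof -
  have "((\<lambda>x. exp (- x\<^sup>2 / 2) :: real) \<longlongrightarrow> 0) at_top" "((\<lambda>x. exp (- x\<^sup>2 / 2) :: real) \<longlongrightarrow> 0) at_bot"
    by real_asymp+
  from this[THEN tendsto_mult_right_zero, of "1 / sqrt (2 * pi)"]
  show "(std_normal_density \<longlongrightarrow> 0) at_top" "(std_normal_density \<longlongrightarrow> 0) at_bot"
    unfolding std_normal_density_def .
qed

text \<open>
  On \<open>[w, \<infinity>)\<close> the function \<open>y \<mapsto> \<phi>(y) / w + \<Phi>(y)\<close> has derivative \<open>\<phi>(y) (1 - y / w) \<le> 0\<close>, and it
  tends to \<open>1\<close>; hence it is at least \<open>1\<close> at \<open>w\<close>.
\<close>

lemma Mills_upper: "w > 0 \<Longrightarrow> w * (1 - Phi w) \<le> std_normal_density w"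
proof -
  assume w: "w > 0"
  let ?H = "\<lambda>y. std_normal_density y / w + Phi y"
  have dec: "?H y \<le> ?H w" if "w \<le> y" for y
  proof (rule DERIV_nonpos_imp_nonincreasing[OF that])
    fix t assume "w \<le> t"
    then have "std_normal_density t * (1 - t / w) \<le> 0"
      using w std_normal_density_bounds(1)[of t] by (intro mult_nonneg_nonpos) auto
    moreover have "(?H has_real_derivative std_normal_density t * (1 - t / w)) (at t)"
      using w by (auto intro!: derivative_eq_intros DERIV_Phi DERIV_std_normal_density
          simp: field_simps)
    ultimately show "\<exists>l. (?H has_real_derivative l) (at t) \<and> l \<le> 0"
      by blast
  qed
  have "(?H \<longlongrightarrow> 0 / w + 1) at_top"
    by (intro tendsto_intros std_normal_density_tendsto_0 std_normal.cdf_lim_at_top_prob) (use w in auto)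
  then have "0 / w + 1 \<le> ?H w"
    by (rule tendsto_upperbound) (auto intro!: eventually_at_top_linorderI[of w] dec)
  then show ?thesis
    using w by (simp add: field_simps)
qed

text \<open>
  Mirror image: \<open>y \<mapsto> \<Phi>(y) + \<phi>(y) / w\<close> decreases on \<open>(- \<infinity>, w]\<close> and tends to \<open>0\<close> at \<open>- \<infinity>\<close>.
\<close>

lemma Mills_lower: "w < 0 \<Longrightarrow> - w * Phi w \<le> std_normal_density w"
proof -
  assume w: "w < 0"
  let ?K = "\<lambda>y. Phi y + std_normal_density y / w"
  have dec: "?K w \<le> ?K y" if "y \<le> w" for y
  proof (rule DERIV_nonpos_imp_nonincreasing[OF that])
    fix t assume "t \<le> w"
    then have "1 \<le> t / w" using w by (simp add: field_simps)
    then have "std_normal_density t * (1 - t / w) \<le> 0"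
      using std_normal_density_bounds(1)[of t] by (intro mult_nonneg_nonpos) auto
    moreover have "(?K has_real_derivative std_normal_density t * (1 - t / w)) (at t)"
      using w by (auto intro!: derivative_eq_intros DERIV_Phi DERIV_std_normal_density
          simp: field_simps)
    ultimately show "\<exists>l. (?K has_real_derivative l) (at t) \<and> l \<le> 0"
      by blast
  qed
  have "(?K \<longlongrightarrow> 0 + 0 / w) at_bot"
    by (intro tendsto_intros std_normal_density_tendsto_0 std_normal.cdf_lim_at_bot) (use w in auto)
  then have "?K w \<le> 0 + 0 / w"
    by (rule tendsto_lowerbound) (auto intro!: eventually_at_bot_linorderI[of w] dec)
  then show ?thesis
    using w by (simp add: field_simps)
qed

section \<open>Stein's equation for half-lines\<close>

text \<open>
  The bounded solution \<open>f\<close> of Stein's equation \<open>f'(w) - w f(w) = 1(w \<le> z) - \<Phi>(z)\<close>. It is usually written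
  with the prefactor \<open>\<surd>(2\<pi>) exp(w\<^sup>2 / 2)\<close>, the reciprocal of the normal density.
\<close>

definition stein :: "real \<Rightarrow> real \<Rightarrow> real" where
  "stein z w = (if w \<le> z then Phi w * (1 - Phi z) else Phi z * (1 - Phi w)) / std_normal_density w"

text \<open>
  The numerator of the solution is at most each of the two tails \<open>\<Phi>(w)\<close> and \<open>1 - \<Phi>(w)\<close>, so the
  Mills ratio bounds apply on both half-lines.
\<close>

lemma mult_stein_bound: "\<bar>w * stein z w\<bar> \<le> 1"
proof -
  have *: "0 \<le> Phi w" "0 \<le> 1 - Phi w" "0 \<le> Phi z" "0 \<le> 1 - Phi z" "Phi z \<le> 1" "Phi w \<le> 1"
    by (auto simp: Phi_nonneg Phi_le_1)
  define u where "u = (if w \<le> z then Phi w * (1 - Phi z) else Phi z * (1 - Phi w))"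
  have u: "0 \<le> u" unfolding u_def using * by auto
  have u1: "u \<le> 1 - Phi w"
  proof (cases "w \<le> z")
    case True
    then have "1 - Phi z \<le> 1 - Phi w" using std_normal.cdf_nondecreasing by auto
    then show ?thesis using True * unfolding u_def
      using mult_right_le_one_le[of "1 - Phi z" "Phi w"] by (simp add: mult.commute)
  qed (use * in \<open>auto simp: u_def intro: mult_left_le_one_le\<close>)
  have u2: "u \<le> Phi w"
  proof (cases "w \<le> z")
    case False
    then have "Phi z \<le> Phi w" using std_normal.cdf_nondecreasing by auto
    then show ?thesis using False * unfolding u_def
      using mult_right_le_one_le[of "Phi z" "1 - Phi w"] by simp
  qed (use * in \<open>auto simp: u_def intro: mult_right_le_one_le\<close>)
  have "\<bar>w\<bar> * u \<le> std_normal_density w"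
  proof (cases "w = 0")
    case False
    then consider "w > 0" | "w < 0" by linarith
    then show ?thesis
    proof cases
      case 1
      then have "w * u \<le> w * (1 - Phi w)" using u1 by simp
      with Mills_upper[OF 1] have "w * u \<le> std_normal_density w" by (rule order_trans[rotated])
      then show ?thesis using 1 by simp
    next
      case 2
      then have "- w * u \<le> - w * Phi w" using u2 by simp
      with Mills_lower[OF 2] have "- w * u \<le> std_normal_density w" by (rule order_trans[rotated])
      then show ?thesis using 2 by simp
    qed
  qed (simp add: less_imp_le std_normal_density_bounds(1))
  then show ?thesis
    using u std_normal_density_bounds(1)[of w]
    by (simp add: stein_def flip: u_def) (simp add: abs_mult)
qed

text \<open>
  Outside \<open>[-1, 1]\<close> this follows from the bound on \<open>w f(w)\<close>; inside, the density is at least \<open>1 / 8\<close>.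
\<close>

lemma stein_bound: "\<bar>stein z w\<bar> \<le> 8"
proof (cases "\<bar>w\<bar> \<le> 1")
  case False
  have "\<bar>w\<bar> * \<bar>stein z w\<bar> \<le> 1"
    using mult_stein_bound[of w z] by (simp add: abs_mult)
  then show ?thesis
    using False mult_right_mono[of 1 "\<bar>w\<bar>" "\<bar>stein z w\<bar>"] by simp
next
  case True
  have *: "0 \<le> Phi w" "0 \<le> 1 - Phi w" "0 \<le> Phi z" "0 \<le> 1 - Phi z" "Phi z \<le> 1" "Phi w \<le> 1"
    by (auto simp: Phi_nonneg Phi_le_1)
  have "1 / 8 \<le> std_normal_density w"
  proof -
    have "w\<^sup>2 \<le> 1"
      using True by (simp add: abs_square_le_1)
    then have "w\<^sup>2 / 2 \<le> 1" by simp
    then have "exp (w\<^sup>2 / 2) \<le> exp 1"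
      by simp
    then have 1: "exp (w\<^sup>2 / 2) \<le> 272 / 100"
      using e_less_272 by linarith
    have "sqrt (2 * pi) \<le> sqrt ((28/10)\<^sup>2)"
      using pi_less_4 pi_approx by (intro real_sqrt_le_mono) (simp add: power2_eq_square)
    then have "sqrt (2 * pi) * exp (w\<^sup>2 / 2) \<le> (28/10) * (272/100)"
      using 1 by (intro mult_mono) auto
    also have "\<dots> \<le> 8" by simp
    finally have "sqrt (2 * pi) * exp (w\<^sup>2 / 2) \<le> 8" .
    moreover have "0 < sqrt (2 * pi) * exp (w\<^sup>2 / 2)" by simp
    ultimately have "1 / 8 \<le> 1 / (sqrt (2 * pi) * exp (w\<^sup>2 / 2))"
      by (intro divide_left_mono) auto
    also have "\<dots> = std_normal_density w"
      by (simp add: std_normal_density_def exp_minus field_simps)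
    finally show ?thesis .
  qed
  moreover have "\<bar>if w \<le> z then Phi w * (1 - Phi z) else Phi z * (1 - Phi w)\<bar> \<le> 1"
    using * by (auto simp: abs_mult intro: mult_le_one)
  ultimately show ?thesis
    unfolding stein_def abs_divide
    using std_normal_density_bounds(1)[of w]
    by (simp add: divide_le_eq)
qed

lemma DERIV_stein:
  assumes "w \<noteq> z"
  shows "(stein z has_real_derivative (w * stein z w + of_bool (w \<le> z) - Phi z)) (at w)"
proof (cases "w < z")
  case True
  have "((\<lambda>w. Phi w * (1 - Phi z) / std_normal_density w) has_real_derivative
      (w * stein z w + of_bool (w \<le> z) - Phi z)) (at w)"
    using True std_normal_density_bounds(1)[of w]
    by (auto intro!: derivative_eq_intros DERIV_Phi DERIV_std_normal_density
        simp: stein_def field_simps)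
  then show ?thesis
    by (rule has_field_derivative_transform_within_open[where S = "{..<z}"])
       (use True in \<open>auto simp: stein_def\<close>)
next
  case False
  then have "w > z" using assms by simp
  have "((\<lambda>w. Phi z * (1 - Phi w) / std_normal_density w) has_real_derivative
      (w * stein z w + of_bool (w \<le> z) - Phi z)) (at w)"
    using \<open>w > z\<close> std_normal_density_bounds(1)[of w]
    by (auto intro!: derivative_eq_intros DERIV_Phi DERIV_std_normal_density
        simp: stein_def field_simps)
  then show ?thesis
    by (rule has_field_derivative_transform_within_open[where S = "{z<..}"])
       (use \<open>w > z\<close> in \<open>auto simp: stein_def\<close>)
qed

lemma continuous_on_stein: "continuous_on A (stein z)"
proof -
  have "continuous_on UNIV (stein z)"
  proof -
    have eq: "stein z w = min (Phi w) (Phi z) * (1 - max (Phi w) (Phi z)) / std_normal_density w" for w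
      using std_normal.cdf_nondecreasing[of w z] std_normal.cdf_nondecreasing[of z w]
      by (auto simp: stein_def min_def max_def)
    have [continuous_intros]: "continuous_on UNIV Phi"
      by (simp add: continuous_on_eq_continuous_at isCont_Phi)
    have "std_normal_density w \<noteq> 0" for w
      using std_normal_density_bounds(1)[of w] by simp
    then show ?thesis
      unfolding eq[abs_def]
      by (intro continuous_intros continuous_std_normal_density) auto
  qed
  then show ?thesis by (rule continuous_on_subset) auto
qed

lemma borel_measurable_stein [measurable]: "stein z \<in> borel_measurable borel"
  by (rule borel_measurable_continuous_onI) (rule continuous_on_stein)

text \<open>
  The solution of Stein's equation has a kink at \<open>z\<close>, so the mean value theorem is applied to the two
  sides of \<open>z\<close> separately.
\<close>

lemma mean_value_bounds_except_point:
  fixes f :: "real \<Rightarrow> real"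
  assumes "a \<le> b" and cont: "continuous_on {a..b} f"
    and der: "\<And>x. a < x \<Longrightarrow> x < b \<Longrightarrow> x \<noteq> z \<Longrightarrow> (f has_real_derivative f' x) (at x)"
    and bnd: "\<And>x. a < x \<Longrightarrow> x < b \<Longrightarrow> x \<noteq> z \<Longrightarrow> m \<le> f' x \<and> f' x \<le> M"
  shows "m * (b - a) \<le> f b - f a" "f b - f a \<le> M * (b - a)"
proof -
  have piece: "m * (d - c) \<le> f d - f c \<and> f d - f c \<le> M * (d - c)"
    if "a \<le> c" "c \<le> d" "d \<le> b" "z \<notin> {c<..<d}" for c d
  proof (cases "c = d")
    case False
    then have "c < d" using that by simp
    have "\<exists>l y. c < y \<and> y < d \<and> (f has_real_derivative l) (at y) \<and> f d - f c = (d - c) * l"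
    proof (rule MVT[OF \<open>c < d\<close>])
      show "continuous_on {c..d} f"
        using cont by (rule continuous_on_subset) (use that in auto)
      show "f differentiable (at x)" if "c < x" "x < d" for x
      proof -
        have "(f has_real_derivative f' x) (at x)"
          by (rule der) (use that \<open>a \<le> c\<close> \<open>d \<le> b\<close> \<open>z \<notin> {c<..<d}\<close> in auto)
        then show ?thesis
          using real_differentiable_def by blast
      qed
    qed
    then obtain l y where y: "c < y" "y < d" "(f has_real_derivative l) (at y)"
      "f d - f c = (d - c) * l" by blast
    have "(f has_real_derivative f' y) (at y)" and b: "m \<le> f' y \<and> f' y \<le> M"
      using der[of y] bnd[of y] y that by auto
    then have "l = f' y" using y(3) DERIV_unique by blast
    then show ?thesis
      using y(4) b \<open>c < d\<close> by (simp add: mult.commute)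
  qed simp
  have "m * (b - a) \<le> f b - f a \<and> f b - f a \<le> M * (b - a)"
  proof (cases "z \<in> {a<..<b}")
    case True
    then show ?thesis
      using piece[of a z] piece[of z b] by (simp add: algebra_simps)
  next
    case False
    then show ?thesis using piece[of a b] \<open>a \<le> b\<close> by simp
  qed
  then show "m * (b - a) \<le> f b - f a" "f b - f a \<le> M * (b - a)" by auto
qed

lemma stein_Lipschitz: "\<bar>stein z x - stein z y\<bar> \<le> 2 * \<bar>x - y\<bar>"
proof -
  have *: "\<bar>stein z x - stein z y\<bar> \<le> 2 * (y - x)" if "x \<le> y" for x y
  proof -
    have "- 2 \<le> w * stein z w + of_bool (w \<le> z) - Phi z \<and>
        w * stein z w + of_bool (w \<le> z) - Phi z \<le> 2" for w
      using mult_stein_bound[of w z] Phi_nonneg[of z] Phi_le_1[of z] by (auto simp: of_bool_def)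
    from mean_value_bounds_except_point[OF that continuous_on_stein, where z = z and m = "-2" and M = 2,
        OF DERIV_stein this]
    show ?thesis by auto
  qed
  show ?thesis
    using *[of x y] *[of y x] by (cases "x \<le> y") (auto simp: abs_minus_commute)
qed

lemma mult_stein_Lipschitz: "\<bar>x * stein z x - w * stein z w\<bar> \<le> (2 * \<bar>w\<bar> + 8) * \<bar>x - w\<bar>"
proof -
  have "\<bar>x * stein z x - w * stein z w\<bar> = \<bar>w * (stein z x - stein z w) + (x - w) * stein z x\<bar>"
    by (simp add: algebra_simps)
  also have "\<dots> \<le> \<bar>w\<bar> * \<bar>stein z x - stein z w\<bar> + \<bar>x - w\<bar> * \<bar>stein z x\<bar>"
    by (metis abs_mult abs_triangle_ineq)
  also have "\<dots> \<le> \<bar>w\<bar> * (2 * \<bar>x - w\<bar>) + \<bar>x - w\<bar> * 8"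
    by (intro add_mono mult_left_mono stein_Lipschitz stein_bound) auto
  finally show ?thesis by (simp add: algebra_simps)
qed

text \<open>
  The deterministic core of Stein's method for bounded summands. Between \<open>w\<close> and \<open>w + h\<close> the derivative
  \<open>x f(x) + 1(x \<le> z) - \<Phi>(z)\<close> stays close to its value at \<open>w\<close>: the first term moves by at most
  \<open>(2|w| + 8) \<delta>\<close>, and the indicator is bracketed by its values at \<open>w\<close> with \<open>z\<close> shifted by \<open>\<delta>\<close> either way. Because \<open>h\<close> enters the right-hand sides only
  through the factor \<open>h\<^sup>2\<close>, independence of \<open>h\<close> and \<open>w\<close> can be used after taking expectations. This
  replaces a zero-bias coupling.
\<close>

lemma stein_increment:
  assumes "\<bar>h\<bar> \<le> \<delta>"
  shows "h\<^sup>2 * (w * stein z w - (2 * \<bar>w\<bar> + 8) * \<delta> + of_bool (w \<le> z - \<delta>) - Phi z)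
      \<le> h * (stein z (w + h) - stein z w)" (is "h\<^sup>2 * ?m \<le> _")
    and "h * (stein z (w + h) - stein z w)
      \<le> h\<^sup>2 * (w * stein z w + (2 * \<bar>w\<bar> + 8) * \<delta> + of_bool (w \<le> z + \<delta>) - Phi z)" (is "_ \<le> h\<^sup>2 * ?M")
proof -
  have bnd: "?m \<le> x * stein z x + of_bool (x \<le> z) - Phi z \<and>
      x * stein z x + of_bool (x \<le> z) - Phi z \<le> ?M" if "\<bar>x - w\<bar> \<le> \<delta>" for x
  proof -
    have "\<bar>x * stein z x - w * stein z w\<bar> \<le> (2 * \<bar>w\<bar> + 8) * \<delta>"
      using mult_stein_Lipschitz[of x z w] that
      by (elim order_trans) (intro mult_left_mono, auto)
    moreover have "(of_bool (w \<le> z - \<delta>) :: real) \<le> of_bool (x \<le> z)"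
      "(of_bool (x \<le> z) :: real) \<le> of_bool (w \<le> z + \<delta>)"
      using that by (auto simp: of_bool_def)
    ultimately show ?thesis by auto
  qed
  have eq: "h * (h * c) = h\<^sup>2 * c" for c
    by (simp add: power2_eq_square)
  have "h\<^sup>2 * ?m \<le> h * (stein z (w + h) - stein z w) \<and>
      h * (stein z (w + h) - stein z w) \<le> h\<^sup>2 * ?M"
  proof (cases "h \<ge> 0")
    case True
    have "?m * (w + h - w) \<le> stein z (w + h) - stein z w"
      "stein z (w + h) - stein z w \<le> ?M * (w + h - w)"
      by (rule mean_value_bounds_except_point[OF _ continuous_on_stein DERIV_stein bnd];
          use True assms in auto)+
    then have "h * ?m \<le> stein z (w + h) - stein z w" "stein z (w + h) - stein z w \<le> h * ?M"
      by (simp_all only: mult.commute[of h] add_diff_cancel_left')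
    from this[THEN mult_left_mono[OF _ True]] show ?thesis
      unfolding eq by blast
  next
    case False
    then have h: "0 \<le> - h" by simp
    have "?m * (w - (w + h)) \<le> stein z w - stein z (w + h)"
      "stein z w - stein z (w + h) \<le> ?M * (w - (w + h))"
      by (rule mean_value_bounds_except_point[OF _ continuous_on_stein DERIV_stein bnd];
          use False assms in auto)+
    then have "- h * ?m \<le> stein z w - stein z (w + h)" "stein z w - stein z (w + h) \<le> - h * ?M"
      by (simp_all only: mult.commute[of "- h"] diff_add_eq_diff_diff_swap) simp_all
    note this[THEN mult_left_mono[OF _ h]]
    moreover have "- h * (stein z w - stein z (w + h)) = h * (stein z (w + h) - stein z w)"
      "- h * (- h * c) = h\<^sup>2 * c" for c
      by (simp_all add: algebra_simps power2_eq_square)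
    ultimately show ?thesis
      by metis
  qed
  then show "h\<^sup>2 * ?m \<le> h * (stein z (w + h) - stein z w)"
    "h * (stein z (w + h) - stein z w) \<le> h\<^sup>2 * ?M"
    by blast+
qed

section \<open>A Berry--Esseen bound for bounded independent summands\<close>

context prob_space
begin

lemma expectation_mult_indep:
  fixes X Y :: "'a \<Rightarrow> real" and f g :: "real \<Rightarrow> real"
  assumes "indep_var borel X borel Y"
    and [measurable]: "f \<in> borel_measurable borel" "g \<in> borel_measurable borel"
    and "integrable M (\<lambda>\<omega>. f (X \<omega>))" "integrable M (\<lambda>\<omega>. g (Y \<omega>))"
  shows "expectation (\<lambda>\<omega>. f (X \<omega>) * g (Y \<omega>)) = expectation (\<lambda>\<omega>. f (X \<omega>)) * expectation (\<lambda>\<omega>. g (Y \<omega>))"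
proof -
  have "indep_var borel (f \<circ> X) borel (g \<circ> Y)"
    by (rule indep_var_compose[OF assms(1)]) measurable
  then show ?thesis
    using indep_var_lebesgue_integral[of "\<lambda>\<omega>. f (X \<omega>)" "\<lambda>\<omega>. g (Y \<omega>)"] assms(4,5) by (simp add: comp_def)
qed

lemma expectation_of_bool: "{\<omega> \<in> space M. P \<omega>} \<in> events \<Longrightarrow> expectation (\<lambda>\<omega>. of_bool (P \<omega>)) = \<P>(\<omega> in M. P \<omega>)"
proof -
  assume "{\<omega> \<in> space M. P \<omega>} \<in> events"
  then have "\<P>(\<omega> in M. P \<omega>) = expectation (indicator {\<omega> \<in> space M. P \<omega>})"
    by simp
  also have "\<dots> = expectation (\<lambda>\<omega>. of_bool (P \<omega>))"
    by (rule Bochner_Integration.integral_cong) (auto simp: indicator_def)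
  finally show ?thesis ..
qed

lemma variance_sum_indep:
  fixes \<xi> :: "'i \<Rightarrow> 'a \<Rightarrow> real"
  assumes "finite I" and indep: "indep_vars (\<lambda>_. borel) \<xi> I"
    and meas: "\<And>i. i \<in> I \<Longrightarrow> \<xi> i \<in> borel_measurable M"
    and bnd: "\<And>i \<omega>. i \<in> I \<Longrightarrow> \<bar>\<xi> i \<omega>\<bar> \<le> \<delta>"
    and mean: "\<And>i. i \<in> I \<Longrightarrow> expectation (\<xi> i) = 0"
  shows "expectation (\<lambda>\<omega>. (\<Sum>i\<in>I. \<xi> i \<omega>)\<^sup>2) = (\<Sum>i\<in>I. expectation (\<lambda>\<omega>. (\<xi> i \<omega>)\<^sup>2))"
  using assms
proof (induction I rule: finite_induct)
  case (insert i I)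
  note [measurable] = insert.prems(2)
  have int: "integrable M (\<xi> j)" "integrable M (\<lambda>\<omega>. (\<xi> j \<omega>)\<^sup>2)" if "j \<in> insert i I" for j
  proof -
    show "integrable M (\<xi> j)"
      by (rule integrable_const_bound[of _ \<delta>]) (use that insert.prems(2,3) in auto)
    show "integrable M (\<lambda>\<omega>. (\<xi> j \<omega>)\<^sup>2)"
      by (rule integrable_const_bound[of _ "\<delta>\<^sup>2"])
         (use that insert.prems(2) power_mono[OF insert.prems(3) abs_ge_zero, where n = 2] in auto)
  qed
  have bndS: "\<bar>\<Sum>j\<in>I. \<xi> j \<omega>\<bar> \<le> card I * \<delta>" for \<omega>
    using insert.prems(3) by (intro order_trans[OF sum_abs] sum_bounded_above) auto
  have intS: "integrable M (\<lambda>\<omega>. \<Sum>j\<in>I. \<xi> j \<omega>)" "integrable M (\<lambda>\<omega>. (\<Sum>j\<in>I. \<xi> j \<omega>)\<^sup>2)"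
    by (intro Bochner_Integration.integrable_sum int, simp)
       (rule integrable_const_bound[of _ "(card I * \<delta>)\<^sup>2"],
        use power_mono[OF bndS abs_ge_zero, where n = 2] in auto)
  have iv: "indep_var borel (\<xi> i) borel (\<lambda>\<omega>. \<Sum>j\<in>I. \<xi> j \<omega>)"
    by (rule indep_vars_sum) (use insert in auto)
  have cross: "expectation (\<lambda>\<omega>. \<xi> i \<omega> * (\<Sum>j\<in>I. \<xi> j \<omega>)) = 0"
    "integrable M (\<lambda>\<omega>. \<xi> i \<omega> * (\<Sum>j\<in>I. \<xi> j \<omega>))"
    using indep_var_lebesgue_integral[OF iv] indep_var_integrable[OF iv] int[of i] intS insert.prems(4)
    by auto
  have "expectation (\<lambda>\<omega>. (\<Sum>j\<in>insert i I. \<xi> j \<omega>)\<^sup>2) =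
      expectation (\<lambda>\<omega>. (\<xi> i \<omega>)\<^sup>2 + (\<Sum>j\<in>I. \<xi> j \<omega>)\<^sup>2 + 2 * (\<xi> i \<omega> * (\<Sum>j\<in>I. \<xi> j \<omega>)))"
    using insert.hyps by (simp add: power2_sum mult.assoc)
  also have "\<dots> = expectation (\<lambda>\<omega>. (\<xi> i \<omega>)\<^sup>2) + expectation (\<lambda>\<omega>. (\<Sum>j\<in>I. \<xi> j \<omega>)\<^sup>2)"
    using int[of i] intS cross by simp
  also have "\<dots> = (\<Sum>j\<in>insert i I. expectation (\<lambda>\<omega>. (\<xi> j \<omega>)\<^sup>2))"
    using insert by (subst insert.IH) (auto intro: indep_vars_subset)
  finally show ?case .
qed simp

text \<open>
  Let \<open>f\<close> solve Stein's equation and let \<open>W\<^sub>i = W - \<xi>\<^sub>i\<close>, which is independent of \<open>\<xi>\<^sub>i\<close>. Since the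
  summands are centred, \<open>\<bbbE>(W f(W)) = \<Sum>\<^sub>i \<bbbE>(\<xi>\<^sub>i (f(W\<^sub>i + \<xi>\<^sub>i) - f(W\<^sub>i)))\<close>. By \<open>stein_increment\<close> this is, up to
  \<open>O(\<delta>)\<close>, the sum over \<open>i\<close> of \<open>\<bbbE>(\<xi>\<^sub>i\<^sup>2)\<close> times \<open>\<bbbE>(W f(W)) + P(W \<le> z) - \<Phi>(z)\<close>, where the
  argument of the distribution function is shifted by \<open>2\<delta>\<close>. As the second moments add up to \<open>v\<close>, the
  terms \<open>\<bbbE>(W f(W))\<close> cancel up to the factor \<open>1 - v\<close>, and what remains is the distance to the normal law.

  The variance \<open>v\<close> is not normalised to \<open>1\<close>: below, \<open>W\<close> is the projection of a variable of
  variance \<open>1\<close> onto functions of single coordinates, which loses a little variance.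
\<close>

theorem Berry_Esseen_bounded:
  fixes \<xi> :: "'i \<Rightarrow> 'a \<Rightarrow> real"
  assumes "finite I" and indep: "indep_vars (\<lambda>_. borel) \<xi> I"
    and meas: "\<And>i. i \<in> I \<Longrightarrow> \<xi> i \<in> borel_measurable M"
    and bnd: "\<And>i \<omega>. i \<in> I \<Longrightarrow> \<bar>\<xi> i \<omega>\<bar> \<le> \<delta>"
    and mean: "\<And>i. i \<in> I \<Longrightarrow> expectation (\<xi> i) = 0"
    and \<delta>: "0 \<le> \<delta>" "\<delta> \<le> 1"
  defines "W \<equiv> \<lambda>\<omega>. \<Sum>i\<in>I. \<xi> i \<omega>"
  defines "v \<equiv> expectation (\<lambda>\<omega>. (W \<omega>)\<^sup>2)"
  assumes v: "1 / 2 \<le> v" "v \<le> 1"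
  shows "\<bar>\<P>(\<omega> in M. W \<omega> \<le> z) - Phi z\<bar> \<le> 26 * \<delta> + 2 * (1 - v)"
proof -
  note [measurable] = meas
  have W_meas [measurable]: "W \<in> borel_measurable M"
    unfolding W_def by measurable
  define W' where "W' i \<omega> = W \<omega> - \<xi> i \<omega>" for i \<omega>
  have W'_meas [measurable]: "W' i \<in> borel_measurable M" if "i \<in> I" for i
    unfolding W'_def using that by measurable
  have bndW: "\<bar>W \<omega>\<bar> \<le> card I * \<delta>" for \<omega>
    unfolding W_def using bnd by (intro order_trans[OF sum_abs] sum_bounded_above) auto
  have iv: "indep_var borel (\<xi> i) borel (W' i)" if "i \<in> I" for i
  proof -
    have "indep_var borel (\<xi> i) borel (\<lambda>\<omega>. \<Sum>j\<in>I - {i}. \<xi> j \<omega>)"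
      by (rule indep_vars_sum) (use assms that in \<open>auto simp: insert_absorb\<close>)
    moreover have "(\<lambda>\<omega>. \<Sum>j\<in>I - {i}. \<xi> j \<omega>) = W' i"
      unfolding W'_def W_def using that \<open>finite I\<close> by (auto simp: sum_diff1)
    ultimately show ?thesis by simp
  qed
  have sq_bnd: "(\<xi> i \<omega>)\<^sup>2 \<le> 1" if "i \<in> I" for i \<omega>
    using bnd[OF that, of \<omega>] \<delta> by (simp add: abs_square_le_1)
  have intW: "integrable M (\<lambda>\<omega>. \<bar>W \<omega>\<bar>)"
    by (rule integrable_const_bound[of _ "card I * \<delta>"]) (use bndW in auto)
  have intW2: "integrable M (\<lambda>\<omega>. (W \<omega>)\<^sup>2)"
    by (rule integrable_const_bound[of _ "(card I * \<delta>)\<^sup>2"])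
       (use power_mono[OF bndW abs_ge_zero, where n = 2] in auto)
  have int\<xi>: "integrable M (\<xi> i)" "integrable M (\<lambda>\<omega>. (\<xi> i \<omega>)\<^sup>2)" if "i \<in> I" for i
  proof -
    show "integrable M (\<xi> i)"
      by (rule integrable_const_bound[of _ \<delta>]) (use bnd that in auto)
    show "integrable M (\<lambda>\<omega>. (\<xi> i \<omega>)\<^sup>2)"
      by (rule integrable_const_bound[of _ 1]) (use sq_bnd that in auto)
  qed
  have v_sum: "v = (\<Sum>i\<in>I. expectation (\<lambda>\<omega>. (\<xi> i \<omega>)\<^sup>2))"
    unfolding v_def W_def by (rule variance_sum_indep) (use assms in auto)
  have abs_W: "expectation (\<lambda>\<omega>. \<bar>W \<omega>\<bar>) \<le> 1"
  proof -
    have "expectation (\<lambda>\<omega>. \<bar>W \<omega>\<bar>) \<le> expectation (\<lambda>\<omega>. (1 + (W \<omega>)\<^sup>2) / 2)"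
    proof (rule integral_mono)
      show "\<bar>W \<omega>\<bar> \<le> (1 + (W \<omega>)\<^sup>2) / 2" for \<omega>
        using zero_le_power2[of "\<bar>W \<omega>\<bar> - 1"] by (simp add: power2_diff)
    qed (use intW intW2 in auto)
    also have "\<dots> = (1 + v) / 2"
      using intW2 unfolding v_def by (simp add: prob_space)
    finally show ?thesis using v by simp
  qed

  have key: "v * (\<P>(\<omega> in M. W \<omega> \<le> z - 2 * \<delta>) - Phi z - 24 * \<delta>) \<le> 1 - v"
            "- (1 - v) \<le> v * (\<P>(\<omega> in M. W \<omega> \<le> z + 2 * \<delta>) - Phi z + 24 * \<delta>)" for z
  proof -
    define A where "A = expectation (\<lambda>\<omega>. W \<omega> * stein z (W \<omega>))"
    let ?g = "\<lambda>s c w. w * stein z w + s * ((2 * \<bar>w\<bar> + 8) * \<delta>) + of_bool (w \<le> c) - Phi z"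
    have int_st [simp]: "integrable M (\<lambda>\<omega>. W \<omega> * stein z (W \<omega>))"
      by (rule integrable_const_bound[of _ 1]) (use mult_stein_bound in auto)
    have ind [simp]: "integrable M (\<lambda>\<omega>. of_bool (W \<omega> \<le> c) :: real)" for c
      by (rule integrable_const_bound[of _ 1]) auto
    have abs_A: "\<bar>A\<bar> \<le> 1"
      unfolding A_def using mult_stein_bound
      by (intro integral_abs_bound[THEN order_trans] integral_le_const) auto
    have int_W': "integrable M (\<lambda>\<omega>. ?g s c (W' i \<omega>))" if "i \<in> I" for i s c
    proof -
      have "\<bar>W' i \<omega>\<bar> \<le> card I * \<delta> + \<delta>" for \<omega>
        unfolding W'_def using bndW[of \<omega>] bnd[OF that, of \<omega>] by auto
      then have "integrable M (\<lambda>\<omega>. \<bar>W' i \<omega>\<bar>)"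
        using that by (intro integrable_const_bound[of _ "card I * \<delta> + \<delta>"]) auto
      moreover have "integrable M (\<lambda>\<omega>. W' i \<omega> * stein z (W' i \<omega>))"
        by (rule integrable_const_bound[of _ 1]) (use that mult_stein_bound in auto)
      moreover have "integrable M (\<lambda>\<omega>. of_bool (W' i \<omega> \<le> c) :: real)"
        by (rule integrable_const_bound[of _ 1]) (use that in auto)
      ultimately show ?thesis by simp
    qed
    have A_sum: "A = (\<Sum>i\<in>I. expectation (\<lambda>\<omega>. \<xi> i \<omega> * (stein z (W' i \<omega> + \<xi> i \<omega>) - stein z (W' i \<omega>))))"
    proof -
      have int1: "integrable M (\<lambda>\<omega>. \<xi> i \<omega> * stein z (W \<omega>))" "integrable M (\<lambda>\<omega>. \<xi> i \<omega> * stein z (W' i \<omega>))"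
        if "i \<in> I" for i
        using that bnd[OF that] stein_bound[of z] \<delta>
        by (auto intro!: integrable_const_bound[of _ "\<delta> * 8"] AE_I2 mult_mono simp: abs_mult)
      have "expectation (\<lambda>\<omega>. \<xi> i \<omega> * stein z (W' i \<omega>)) = 0" if "i \<in> I" for i
      proof -
        have "expectation (\<lambda>\<omega>. \<xi> i \<omega> * stein z (W' i \<omega>)) = expectation (\<xi> i) * expectation (\<lambda>\<omega>. stein z (W' i \<omega>))"
          using that stein_bound[of z]
          by (intro expectation_mult_indep[OF iv, where f = "\<lambda>x. x"] int\<xi> integrable_const_bound[of _ 8] AE_I2) auto
        then show ?thesis using mean that by simp
      qed
      then have "(\<Sum>i\<in>I. expectation (\<lambda>\<omega>. \<xi> i \<omega> * (stein z (W' i \<omega> + \<xi> i \<omega>) - stein z (W' i \<omega>)))) =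
          (\<Sum>i\<in>I. expectation (\<lambda>\<omega>. \<xi> i \<omega> * stein z (W \<omega>)))"
        using int1 by (intro sum.cong) (auto simp: W'_def right_diff_distrib)
      also have "\<dots> = expectation (\<lambda>\<omega>. \<Sum>i\<in>I. \<xi> i \<omega> * stein z (W \<omega>))"
        using int1 by (intro Bochner_Integration.integral_sum[symmetric]) auto
      also have "\<dots> = A"
        unfolding A_def W_def by (simp add: sum_distrib_right)
      finally show ?thesis ..
    qed
    have int_inc: "integrable M (\<lambda>\<omega>. \<xi> i \<omega> * (stein z (W' i \<omega> + \<xi> i \<omega>) - stein z (W' i \<omega>)))" if "i \<in> I" for i
    proof (rule integrable_const_bound[of _ "\<delta> * 16"])
      have "\<bar>stein z a - stein z b\<bar> \<le> 16" for a b
        using stein_bound[of z a] stein_bound[of z b] by linarith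
      then show "AE \<omega> in M. norm (\<xi> i \<omega> * (stein z (W' i \<omega> + \<xi> i \<omega>) - stein z (W' i \<omega>))) \<le> \<delta> * 16"
        using bnd[OF that] \<delta> by (auto intro!: AE_I2 mult_mono simp: abs_mult)
    qed (use that in measurable)
    have factor: "expectation (\<lambda>\<omega>. (\<xi> i \<omega>)\<^sup>2 * ?g s c (W' i \<omega>)) =
        expectation (\<lambda>\<omega>. (\<xi> i \<omega>)\<^sup>2) * expectation (\<lambda>\<omega>. ?g s c (W' i \<omega>))"
      "integrable M (\<lambda>\<omega>. (\<xi> i \<omega>)\<^sup>2 * ?g s c (W' i \<omega>))" if "i \<in> I" for i s c
    proof -
      show "expectation (\<lambda>\<omega>. (\<xi> i \<omega>)\<^sup>2 * ?g s c (W' i \<omega>)) =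
        expectation (\<lambda>\<omega>. (\<xi> i \<omega>)\<^sup>2) * expectation (\<lambda>\<omega>. ?g s c (W' i \<omega>))"
        by (rule expectation_mult_indep[OF iv[OF that], where f = "\<lambda>x. x\<^sup>2" and g = "?g s c"])
           (use that int\<xi> int_W' in auto)
      show "integrable M (\<lambda>\<omega>. (\<xi> i \<omega>)\<^sup>2 * ?g s c (W' i \<omega>))"
      proof (rule Bochner_Integration.integrable_bound[OF int_W'[OF that, of s c]])
        show "AE \<omega> in M. norm ((\<xi> i \<omega>)\<^sup>2 * ?g s c (W' i \<omega>)) \<le> norm (?g s c (W' i \<omega>))"
          using sq_bnd[OF that] by (intro AE_I2) (simp add: abs_mult mult_left_le_one_le)
      qed (use that in measurable)
    qed
    have dW: "\<bar>W' i \<omega> * stein z (W' i \<omega>) - W \<omega> * stein z (W \<omega>)\<bar> \<le> (2 * \<bar>W \<omega>\<bar> + 8) * \<delta>"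
      "\<bar>W' i \<omega>\<bar> \<le> \<bar>W \<omega>\<bar> + 1" if "i \<in> I" for i \<omega>
    proof -
      have "\<bar>W' i \<omega> - W \<omega>\<bar> \<le> \<delta>" using bnd[OF that, of \<omega>] by (simp add: W'_def)
      then show "\<bar>W' i \<omega>\<bar> \<le> \<bar>W \<omega>\<bar> + 1" using \<delta> by linarith
      show "\<bar>W' i \<omega> * stein z (W' i \<omega>) - W \<omega> * stein z (W \<omega>)\<bar> \<le> (2 * \<bar>W \<omega>\<bar> + 8) * \<delta>"
        using mult_stein_Lipschitz[of "W' i \<omega>" z "W \<omega>"] \<open>\<bar>W' i \<omega> - W \<omega>\<bar> \<le> \<delta>\<close>
        by (elim order_trans) (intro mult_left_mono, auto)
    qed
    \<comment> \<open>The two Lipschitz errors, one from moving along \<open>\<xi>\<^sub>i\<close> and one from replacing \<open>W\<^sub>i\<close> by \<open>W\<close>, add up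
      to at most \<open>(2 (|W| + 1) + 8) \<delta> + (2 |W| + 8) \<delta>\<close>.\<close>
    have err: "expectation (\<lambda>\<omega>. (4 * \<bar>W \<omega>\<bar> + 18) * \<delta>) \<le> 24 * \<delta>"
    proof -
      have "expectation (\<lambda>\<omega>. (4 * \<bar>W \<omega>\<bar> + 18) * \<delta>) = (4 * expectation (\<lambda>\<omega>. \<bar>W \<omega>\<bar>) + 18) * \<delta>"
        using intW by (simp add: prob_space)
      also have "\<dots> \<le> 24 * \<delta>"
        using abs_W \<delta> by (intro mult_right_mono) auto
      finally show ?thesis .
    qed
    have int_err: "integrable M (\<lambda>\<omega>. (4 * \<bar>W \<omega>\<bar> + 18) * \<delta>)"
      using intW by simp

    have lower: "A + \<P>(\<omega> in M. W \<omega> \<le> z - 2 * \<delta>) - Phi z - 24 * \<delta> \<le> expectation (\<lambda>\<omega>. ?g (-1) (z - \<delta>) (W' i \<omega>))"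
      if "i \<in> I" for i
    proof -
      have "A + \<P>(\<omega> in M. W \<omega> \<le> z - 2 * \<delta>) - Phi z - 24 * \<delta> \<le>
          A + \<P>(\<omega> in M. W \<omega> \<le> z - 2 * \<delta>) - Phi z - expectation (\<lambda>\<omega>. (4 * \<bar>W \<omega>\<bar> + 18) * \<delta>)"
        using err by simp
      also have "\<dots> = expectation (\<lambda>\<omega>. W \<omega> * stein z (W \<omega>) + of_bool (W \<omega> \<le> z - 2 * \<delta>) - Phi z - (4 * \<bar>W \<omega>\<bar> + 18) * \<delta>)"
        using int_err by (simp add: A_def expectation_of_bool prob_space)
      also have "\<dots> \<le> expectation (\<lambda>\<omega>. ?g (-1) (z - \<delta>) (W' i \<omega>))"
      proof (rule integral_mono)
        fix \<omega>
        have "(2 * \<bar>W' i \<omega>\<bar> + 8) * \<delta> \<le> (2 * (\<bar>W \<omega>\<bar> + 1) + 8) * \<delta>"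
          using dW(2)[OF that, of \<omega>] \<delta> by (intro mult_right_mono) auto
        moreover have "(of_bool (W \<omega> \<le> z - 2 * \<delta>) :: real) \<le> of_bool (W' i \<omega> \<le> z - \<delta>)"
          using bnd[OF that, of \<omega>] by (auto simp: of_bool_def W'_def)
        ultimately show "W \<omega> * stein z (W \<omega>) + of_bool (W \<omega> \<le> z - 2 * \<delta>) - Phi z - (4 * \<bar>W \<omega>\<bar> + 18) * \<delta>
            \<le> ?g (-1) (z - \<delta>) (W' i \<omega>)"
          using dW(1)[OF that, of \<omega>, THEN abs_le_D2] by (simp add: algebra_simps)
      qed (use int_W'[OF that, of "-1"] int_err in \<open>auto simp del: integrable_mult_left_iff\<close>)
      finally show ?thesis .
    qed
    have upper: "expectation (\<lambda>\<omega>. ?g 1 (z + \<delta>) (W' i \<omega>)) \<le> A + \<P>(\<omega> in M. W \<omega> \<le> z + 2 * \<delta>) - Phi z + 24 * \<delta>"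
      if "i \<in> I" for i
    proof -
      have "expectation (\<lambda>\<omega>. ?g 1 (z + \<delta>) (W' i \<omega>)) \<le>
          expectation (\<lambda>\<omega>. W \<omega> * stein z (W \<omega>) + of_bool (W \<omega> \<le> z + 2 * \<delta>) - Phi z + (4 * \<bar>W \<omega>\<bar> + 18) * \<delta>)"
      proof (rule integral_mono)
        fix \<omega>
        have "(2 * \<bar>W' i \<omega>\<bar> + 8) * \<delta> \<le> (2 * (\<bar>W \<omega>\<bar> + 1) + 8) * \<delta>"
          using dW(2)[OF that, of \<omega>] \<delta> by (intro mult_right_mono) auto
        moreover have "(of_bool (W' i \<omega> \<le> z + \<delta>) :: real) \<le> of_bool (W \<omega> \<le> z + 2 * \<delta>)"
          using bnd[OF that, of \<omega>] by (auto simp: of_bool_def W'_def)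
        ultimately show "?g 1 (z + \<delta>) (W' i \<omega>) \<le> W \<omega> * stein z (W \<omega>) + of_bool (W \<omega> \<le> z + 2 * \<delta>) - Phi z + (4 * \<bar>W \<omega>\<bar> + 18) * \<delta>"
          using dW(1)[OF that, of \<omega>, THEN abs_le_D1] by (simp add: algebra_simps)
      qed (use int_W'[OF that, of 1] int_err in \<open>auto simp del: integrable_mult_left_iff\<close>)
      also have "\<dots> = A + \<P>(\<omega> in M. W \<omega> \<le> z + 2 * \<delta>) - Phi z + expectation (\<lambda>\<omega>. (4 * \<bar>W \<omega>\<bar> + 18) * \<delta>)"
        using int_err by (simp add: A_def expectation_of_bool prob_space)
      also have "\<dots> \<le> A + \<P>(\<omega> in M. W \<omega> \<le> z + 2 * \<delta>) - Phi z + 24 * \<delta>"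
        using err by simp
      finally show ?thesis .
    qed
    let ?v = "\<lambda>i. expectation (\<lambda>\<omega>. (\<xi> i \<omega>)\<^sup>2)"
    have "v * (A + \<P>(\<omega> in M. W \<omega> \<le> z - 2 * \<delta>) - Phi z - 24 * \<delta>) =
        (\<Sum>i\<in>I. ?v i * (A + \<P>(\<omega> in M. W \<omega> \<le> z - 2 * \<delta>) - Phi z - 24 * \<delta>))"
      by (simp add: v_sum sum_distrib_right)
    also have "\<dots> \<le> (\<Sum>i\<in>I. ?v i * expectation (\<lambda>\<omega>. ?g (-1) (z - \<delta>) (W' i \<omega>)))"
      by (intro sum_mono mult_left_mono lower) auto
    also have "\<dots> = (\<Sum>i\<in>I. expectation (\<lambda>\<omega>. (\<xi> i \<omega>)\<^sup>2 * ?g (-1) (z - \<delta>) (W' i \<omega>)))"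
      by (intro sum.cong refl factor(1)[symmetric])
    also have "\<dots> \<le> A"
      unfolding A_sum using stein_increment(1)[OF bnd]
      by (intro sum_mono integral_mono factor(2) int_inc) auto
    finally have 1: "v * (A + \<P>(\<omega> in M. W \<omega> \<le> z - 2 * \<delta>) - Phi z - 24 * \<delta>) \<le> A" .
    have "A \<le> (\<Sum>i\<in>I. expectation (\<lambda>\<omega>. (\<xi> i \<omega>)\<^sup>2 * ?g 1 (z + \<delta>) (W' i \<omega>)))"
      unfolding A_sum using stein_increment(2)[OF bnd]
      by (intro sum_mono integral_mono factor(2) int_inc) auto
    also have "\<dots> = (\<Sum>i\<in>I. ?v i * expectation (\<lambda>\<omega>. ?g 1 (z + \<delta>) (W' i \<omega>)))"
      by (intro sum.cong refl factor(1))
    also have "\<dots> \<le> (\<Sum>i\<in>I. ?v i * (A + \<P>(\<omega> in M. W \<omega> \<le> z + 2 * \<delta>) - Phi z + 24 * \<delta>))"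
      by (intro sum_mono mult_left_mono upper) auto
    also have "\<dots> = v * (A + \<P>(\<omega> in M. W \<omega> \<le> z + 2 * \<delta>) - Phi z + 24 * \<delta>)"
      by (simp add: v_sum sum_distrib_right)
    finally have 2: "A \<le> v * (A + \<P>(\<omega> in M. W \<omega> \<le> z + 2 * \<delta>) - Phi z + 24 * \<delta>)" .
    have "\<bar>(1 - v) * A\<bar> \<le> (1 - v) * 1"
      unfolding abs_mult using abs_A v by (intro mult_mono) auto
    then show "v * (\<P>(\<omega> in M. W \<omega> \<le> z - 2 * \<delta>) - Phi z - 24 * \<delta>) \<le> 1 - v"
      "- (1 - v) \<le> v * (\<P>(\<omega> in M. W \<omega> \<le> z + 2 * \<delta>) - Phi z + 24 * \<delta>)"
      using 1 2 by (auto simp: algebra_simps abs_le_iff)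
  qed
  have half: "x \<le> 2 * (1 - v)" if "v * x \<le> 1 - v" for x
  proof (cases "x \<le> 0")
    case False
    then have "1 / 2 * x \<le> v * x" using v by (intro mult_right_mono) auto
    then show ?thesis using that by simp
  qed (use v in auto)
  have "\<P>(\<omega> in M. W \<omega> \<le> z) - Phi (z + 2 * \<delta>) - 24 * \<delta> \<le> 2 * (1 - v)"
    by (rule half) (use key(1)[of "z + 2 * \<delta>"] in simp)
  moreover have "- (\<P>(\<omega> in M. W \<omega> \<le> z) - Phi (z - 2 * \<delta>) + 24 * \<delta>) \<le> 2 * (1 - v)"
    by (rule half, unfold mult_minus_right) (use key(2)[of "z - 2 * \<delta>"] in simp)
  moreover have "Phi (z + 2 * \<delta>) \<le> Phi z + 2 * \<delta>" "Phi z \<le> Phi (z - 2 * \<delta>) + 2 * \<delta>"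
    using Phi_Lipschitz[of z "z + 2 * \<delta>"] Phi_Lipschitz[of "z - 2 * \<delta>" z] \<delta> by auto
  ultimately show ?thesis
    unfolding abs_le_iff by linarith
qed

end

section \<open>Exponential clocks\<close>

definition exp_law :: "real \<Rightarrow> real measure" where
  "exp_law l = density lborel (exponential_density l)"

lemma sets_exp_law [simp, measurable_cong]: "sets (exp_law l) = sets borel"
  and space_exp_law [simp]: "space (exp_law l) = UNIV"
  by (auto simp: exp_law_def)

lemma measurable_exp_law [simp]: "measurable (exp_law l) N = measurable borel N"
  by (rule measurable_cong_sets) auto

lemma prob_space_exp_law: "0 < l \<Longrightarrow> prob_space (exp_law l)"
  unfolding exp_law_def by (rule prob_space_exponential_density)

text \<open>
  One integral with three uses: for \<open>c = 0\<close> it is a tail probability, for \<open>t = 0\<close> the Laplace transform, and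
  in general one round of the race between clocks below.
\<close>

lemma nn_integral_exp_law_tail:
  assumes l: "0 < l" and c: "0 \<le> c" and t: "0 \<le> t"
  shows "(\<integral>\<^sup>+x. indicator {t<..} x * ennreal (exp (- c * max 0 x)) \<partial>exp_law l)
    = ennreal (l / (l + c) * exp (- (l + c) * t))"
proof -
  have "(\<integral>\<^sup>+x. indicator {t<..} x * ennreal (exp (- c * max 0 x)) \<partial>exp_law l)
      = (\<integral>\<^sup>+x. ennreal (exponential_density l x) * (indicator {t<..} x * ennreal (exp (- c * max 0 x))) \<partial>lborel)"
    unfolding exp_law_def by (subst nn_integral_density) auto
  also have "\<dots> = (\<integral>\<^sup>+x. ennreal (l * exp (- (l + c) * x)) * indicator {t..} x \<partial>lborel)"
  proof (rule nn_integral_cong_AE, use AE_lborel_singleton[of t] in eventually_elim)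
    fix x :: real assume "x \<noteq> t"
    then show "ennreal (exponential_density l x) * (indicator {t<..} x * ennreal (exp (- c * max 0 x)))
        = ennreal (l * exp (- (l + c) * x)) * indicator {t..} x"
      using t l by (auto simp: exponential_density_def indicator_def max_def
          simp flip: ennreal_mult exp_add) (auto simp: algebra_simps)
  qed
  also have "\<dots> = ennreal (0 - (- l / (l + c) * exp (- (l + c) * t)))"
  proof (rule nn_integral_FTC_atLeast)
    have "((\<lambda>x. - l / k * exp (- k * x)) has_real_derivative l * exp (- k * x)) (at x)"
      "((\<lambda>x. - l / k * exp (- k * x)) \<longlongrightarrow> 0) at_top" if "0 < k" for k x
      using that by (auto intro!: derivative_eq_intros) real_asymp
    moreover have "0 < l + c" using l c by simp
    ultimately show "((\<lambda>x. - l / (l + c) * exp (- (l + c) * x)) has_real_derivative l * exp (- (l + c) * x)) (at x)"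
      "((\<lambda>x. - l / (l + c) * exp (- (l + c) * x)) \<longlongrightarrow> 0) at_top" for x
      by blast+
  qed (use l in auto)
  finally show ?thesis by simp
qed

lemma AE_exp_law: "0 < l \<Longrightarrow> AE x in exp_law l. 0 < x"
proof -
  assume l: "0 < l"
  interpret prob_space "exp_law l" by (rule prob_space_exp_law) fact
  have "emeasure (exp_law l) {0<..} = (\<integral>\<^sup>+x. indicator {0<..} x * ennreal (exp (- 0 * max 0 x)) \<partial>exp_law l)"
    by simp
  also have "\<dots> = 1" using nn_integral_exp_law_tail[OF l, of 0 0] l by simp
  finally have "prob {0<..} = 1" by (simp add: emeasure_eq_measure)
  then show ?thesis using AE_prob_1[of "{0<..}"] by simp
qed

text \<open>
  For a rate \<open>c\<close> and any real \<open>x\<close>, negative ones included, this is the probability that an exponential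
  clock of rate \<open>c\<close> rings after \<open>x\<close>. With the truncation at \<open>0\<close> conditional expectations given another
  clock hold at every point and not just almost everywhere.
\<close>

definition exp_tail :: "real \<Rightarrow> real \<Rightarrow> real" where
  "exp_tail c x = exp (- c * max 0 x)"

lemma exp_tail_measurable [measurable]: "exp_tail c \<in> borel_measurable borel"
  unfolding exp_tail_def by measurable

lemma exp_tail_bounds: "0 \<le> c \<Longrightarrow> 0 \<le> exp_tail c x \<and> exp_tail c x \<le> 1"
  unfolding exp_tail_def by auto

lemma exp_tail_mult: "exp_tail c x * exp_tail d x = exp_tail (c + d) x"
  unfolding exp_tail_def by (simp add: algebra_simps flip: exp_add)

lemma integral_exp_tail:
  assumes l: "0 < l" and c: "0 \<le> c"
  shows "(\<integral>x. exp_tail c x \<partial>exp_law l) = l / (l + c)"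
proof -
  have "(\<integral>\<^sup>+x. ennreal (exp_tail c x) \<partial>exp_law l) = (\<integral>\<^sup>+x. indicator {0<..} x * ennreal (exp (- c * max 0 x)) \<partial>exp_law l)"
    by (rule nn_integral_cong_AE, use AE_exp_law[OF l] in eventually_elim) (auto simp: exp_tail_def)
  also have "\<dots> = ennreal (l / (l + c))"
    using nn_integral_exp_law_tail[OF l c, of 0] by simp
  finally show ?thesis
    using l c by (intro integral_eq_nn_integral[THEN trans]) (auto simp: exp_tail_bounds)
qed

lemma measure_exp_law_greaterThan:
  assumes l: "0 < l"
  shows "measure (exp_law l) {t<..} = exp_tail l t"
proof -
  interpret prob_space "exp_law l" by (rule prob_space_exp_law) fact
  have "emeasure (exp_law l) {t<..} = emeasure (exp_law l) {max 0 t<..}"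
    by (rule emeasure_eq_AE) (use AE_exp_law[OF l] in \<open>auto elim!: eventually_mono\<close>)
  also have "\<dots> = (\<integral>\<^sup>+x. indicator {max 0 t<..} x * ennreal (exp (- 0 * max 0 x)) \<partial>exp_law l)"
    by simp
  also have "\<dots> = ennreal (exp_tail l t)"
    using nn_integral_exp_law_tail[OF l, of 0 "max 0 t"] l by (simp add: exp_tail_def)
  finally show ?thesis by (simp add: emeasure_eq_measure exp_tail_def)
qed

lemma measure_exp_law_lessThan:
  assumes l: "0 < l"
  shows "measure (exp_law l) {..<t} = 1 - exp_tail l t"
proof -
  interpret prob_space "exp_law l" by (rule prob_space_exp_law) fact
  have "AE x in exp_law l. x \<noteq> t"
    unfolding exp_law_def by (subst AE_density) (use AE_lborel_singleton[of t] in \<open>auto elim!: eventually_mono\<close>)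
  then have "prob {..<t} = prob {..t}"
    by (intro finite_measure_eq_AE) (auto elim!: eventually_mono)
  also have "\<dots> = prob (space (exp_law l) - {t<..})"
    by (rule arg_cong[of _ _ prob]) auto
  also have "\<dots> = 1 - exp_tail l t"
    using measure_exp_law_greaterThan[OF l, of t] by (subst prob_compl) auto
  finally show ?thesis .
qed

locale exponential_clocks =
  fixes I :: "nat set" and \<theta> :: "nat \<Rightarrow> real"
  assumes finite_I: "finite I" and \<theta>_pos: "\<And>i. 0 < \<theta> i"
begin

abbreviation "\<mu> i \<equiv> exp_law (\<theta> i)"

sublocale product_prob_space "\<lambda>i. \<mu> i" I
  by (rule product_prob_spaceI) (rule prob_space_exp_law, rule \<theta>_pos)

lemma prob_UNIV [simp]: "measure (\<mu> i) UNIV = 1"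
  using M.prob_space[of i] by simp

end

text \<open>
  The Luce weight of a list of competitors: the first one wins against all, and the rest is a race among
  the others.
\<close>

fun race_weight :: "('a \<Rightarrow> real) \<Rightarrow> 'a list \<Rightarrow> real" where
  "race_weight \<theta> [] = 1"
| "race_weight \<theta> (x # xs) = \<theta> x / sum_list (map \<theta> (x # xs)) * race_weight \<theta> xs"

lemma race_weight_nonneg: "(\<And>x. 0 < \<theta> x) \<Longrightarrow> 0 \<le> race_weight \<theta> xs"
  by (induction xs) (auto intro!: divide_nonneg_nonneg mult_nonneg_nonneg add_nonneg_nonneg sum_list_nonneg simp: less_imp_le)

lemma sorted_wrt_less_Cons2:
  "sorted_wrt (<) ((x::real) # y # ys) \<longleftrightarrow> x < y \<and> sorted_wrt (<) (y # ys)"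
  by (auto dest: less_trans)

lemma measurable_clock:
  "i \<in> J \<Longrightarrow> (\<lambda>X. X i) \<in> borel_measurable (Pi\<^sub>M J (\<lambda>i. exp_law (\<theta> i)))"
  using measurable_component_singleton[of i J "\<lambda>i. exp_law (\<theta> i)"] by (simp cong: measurable_cong_sets)

lemma race_measurable:
  assumes "set xs \<subseteq> J"
  shows "Measurable.pred (Pi\<^sub>M J (\<lambda>i. exp_law (\<theta> i))) (\<lambda>X. sorted_wrt (<) (t # map X xs))"
  using assms
proof (induction xs arbitrary: t)
  case (Cons x xs)
  have eq: "(\<lambda>X. sorted_wrt (<) (t # map X (x # xs))) =
      (\<lambda>X. t < X x \<and> (\<forall>z\<in>set xs. X x < X z) \<and> sorted_wrt (<) (t # map X xs))"
    by (auto simp: fun_eq_iff dest: less_trans)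
  show ?case
    unfolding eq
    using Cons by (intro pred_intros_logic pred_intros_finite borel_measurable_pred_less measurable_clock borel_measurable_const) auto
qed simp

text \<open>
  The first clock \<open>x\<close> of the list rings at some time \<open>y > t\<close>, and then the others race from time \<open>y\<close> on.
  The induction hypothesis contributes the factor \<open>exp(- S y)\<close> with \<open>S\<close> the total rate of the
  others, and integrating it over \<open>y\<close> yields the winning probability \<open>\<theta>\<^sub>x / (\<theta>\<^sub>x + S)\<close>. The starting time \<open>t\<close>
  has to be arbitrary for this recursion.
\<close>

lemma nn_integral_race:
  fixes \<theta> :: "nat \<Rightarrow> real"
  assumes \<theta>: "\<And>i. 0 < \<theta> i" and "distinct xs" "0 \<le> t"
  shows "(\<integral>\<^sup>+X. of_bool (sorted_wrt (<) (t # map X xs)) \<partial>Pi\<^sub>M (set xs) (\<lambda>i. exp_law (\<theta> i)))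
    = ennreal (race_weight \<theta> xs * exp (- sum_list (map \<theta> xs) * t))"
  using assms(2,3)
proof (induction xs arbitrary: t)
  case Nil
  interpret exponential_clocks "{}" \<theta> by standard (use \<theta> in auto)
  show ?case by (simp add: P.emeasure_space_1)
next
  case (Cons x xs)
  interpret exponential_clocks "set xs" \<theta> by standard (use \<theta> in auto)
  let ?S = "sum_list (map \<theta> xs)"
  have S: "0 \<le> ?S" by (rule sum_list_nonneg) (use \<theta> in \<open>auto simp: less_imp_le\<close>)
  have w: "0 \<le> race_weight \<theta> xs" using race_weight_nonneg \<theta> by blast
  have eq: "of_bool (sorted_wrt (<) (t # map (X(x := y)) (x # xs))) =
      (of_bool (t < y) * of_bool (sorted_wrt (<) (y # map X xs)) :: ennreal)" for X y
  proof -
    have "map (X(x := y)) xs = map X xs" using Cons.prems(1) by auto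
    then have "sorted_wrt (<) (t # map (X(x := y)) (x # xs)) \<longleftrightarrow> t < y \<and> sorted_wrt (<) (y # map X xs)"
      unfolding list.map sorted_wrt_less_Cons2 by (simp only: fun_upd_same)
    then show ?thesis by (simp only: of_bool_conj)
  qed
  have "(\<integral>\<^sup>+X. of_bool (sorted_wrt (<) (t # map X (x # xs))) \<partial>Pi\<^sub>M (set (x # xs)) (\<lambda>i. exp_law (\<theta> i)))
      = (\<integral>\<^sup>+y. \<integral>\<^sup>+X. of_bool (t < y) * of_bool (sorted_wrt (<) (y # map X xs)) \<partial>Pi\<^sub>M (set xs) (\<lambda>i. exp_law (\<theta> i)) \<partial>exp_law (\<theta> x))"
  proof -
    have "(\<lambda>X. of_bool (sorted_wrt (<) (t # map X (x # xs))) :: ennreal)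
        \<in> borel_measurable (Pi\<^sub>M (insert x (set xs)) (\<lambda>i. exp_law (\<theta> i)))"
      by (rule measurable_compose[OF race_measurable measurable_of_bool]) simp
    then have "(\<integral>\<^sup>+X. of_bool (sorted_wrt (<) (t # map X (x # xs))) \<partial>Pi\<^sub>M (insert x (set xs)) (\<lambda>i. exp_law (\<theta> i)))
      = (\<integral>\<^sup>+y. \<integral>\<^sup>+X. of_bool (sorted_wrt (<) (t # map (X(x := y)) (x # xs))) \<partial>Pi\<^sub>M (set xs) (\<lambda>i. exp_law (\<theta> i)) \<partial>exp_law (\<theta> x))"
      using Cons.prems(1) by (intro product_nn_integral_insert_rev) (auto simp del: sorted_wrt.simps)
    then show ?thesis unfolding eq list.set(2) .
  qed
  also have "\<dots> = (\<integral>\<^sup>+y. ennreal (race_weight \<theta> xs) * (indicator {t<..} y * ennreal (exp (- ?S * max 0 y))) \<partial>exp_law (\<theta> x))"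
  proof (rule nn_integral_cong)
    fix y
    show "(\<integral>\<^sup>+X. of_bool (t < y) * of_bool (sorted_wrt (<) (y # map X xs)) \<partial>Pi\<^sub>M (set xs) (\<lambda>i. exp_law (\<theta> i)))
        = ennreal (race_weight \<theta> xs) * (indicator {t<..} y * ennreal (exp (- ?S * max 0 y)))"
    proof (cases "t < y")
      case True
      then have "0 \<le> y" using Cons.prems by simp
      then show ?thesis
        using True Cons.IH[of y] Cons.prems(1)
        by (simp add: ennreal_mult'[OF w] max_absorb2 del: sorted_wrt.simps)
    qed simp
  qed
  also have "\<dots> = ennreal (race_weight \<theta> xs) * ennreal (\<theta> x / (\<theta> x + ?S) * exp (- (\<theta> x + ?S) * t))"
    by (subst nn_integral_cmult, simp, subst nn_integral_exp_law_tail) (use \<theta> S Cons.prems in auto)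
  also have "\<dots> = ennreal (race_weight \<theta> (x # xs) * exp (- sum_list (map \<theta> (x # xs)) * t))"
  proof -
    have "race_weight \<theta> (x # xs) * exp (- sum_list (map \<theta> (x # xs)) * t)
        = race_weight \<theta> xs * (\<theta> x / (\<theta> x + ?S) * exp (- (\<theta> x + ?S) * t))"
      by simp
    then show ?thesis
      by (simp only: ennreal_mult'[OF w])
  qed
  finally show ?case .
qed

section \<open>The Luce distribution as the order of exponential clocks\<close>

lemma sum_list_map_upt: "sum_list (map f [m..<n]) = sum f {m..<n}"
  by (simp add: interv_sum_list_conv_sum_set_nat)

lemma race_weight_upt:
  "race_weight \<theta> (map \<tau> [k..<Suc n]) = (\<Prod>i=k..n. \<theta> (\<tau> i) / (\<Sum>j=i..n. \<theta> (\<tau> j)))"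
proof (cases "k \<le> Suc n")
  case True
  then show ?thesis
  proof (induction k rule: inc_induct)
    case (step k)
    have "sum_list (map \<theta> (map \<tau> [k..<Suc n])) = (\<Sum>j=k..n. \<theta> (\<tau> j))"
      unfolding map_map by (simp only: sum_list_map_upt atLeastLessThanSuc_atLeastAtMost comp_def)
    moreover have "[k..<Suc n] = k # [Suc k..<Suc n]"
      using step.hyps by (simp add: upt_conv_Cons del: upt_Suc)
    ultimately have "race_weight \<theta> (map \<tau> [k..<Suc n]) =
        \<theta> (\<tau> k) / (\<Sum>j=k..n. \<theta> (\<tau> j)) * race_weight \<theta> (map \<tau> [Suc k..<Suc n])"
      by (simp del: upt_Suc)
    also have "\<dots> = (\<Prod>i=k..n. \<theta> (\<tau> i) / (\<Sum>j=i..n. \<theta> (\<tau> j)))"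
      using step by (simp add: prod.atLeast_Suc_atMost[of k n])
    finally show ?case .
  qed simp
qed simp

lemma luce_weight_eq_race_weight:
  "luce_weight n (\<lambda>i. \<theta> (\<tau> i)) = race_weight \<theta> (map \<tau> [1..<Suc n])"
proof -
  have "(\<Sum>j=1..n. \<theta> (\<tau> j)) - (\<Sum>j\<in>{1..<i}. \<theta> (\<tau> j)) = (\<Sum>j=i..n. \<theta> (\<tau> j))" if "i \<in> {1..n}" for i
  proof -
    have "{1..n} = {1..<i} \<union> {i..n}" using that by auto
    then have "(\<Sum>j=1..n. \<theta> (\<tau> j)) = (\<Sum>j\<in>{1..<i}. \<theta> (\<tau> j)) + (\<Sum>j=i..n. \<theta> (\<tau> j))"
      by (metis finite_atLeastAtMost finite_atLeastLessThan ivl_disj_int_two(7) sum.union_disjoint)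
    then show ?thesis by simp
  qed
  then show ?thesis
    unfolding race_weight_upt luce_weight_def by (intro prod.cong) auto
qed

definition clock_inversions :: "nat \<Rightarrow> (nat \<Rightarrow> real) \<Rightarrow> real" where
  "clock_inversions n X = (\<Sum>i=1..n. \<Sum>j\<in>{i<..n}. of_bool (X j < X i))"

lemma occ21_eq_sum: "real (occ21 n \<sigma>) = (\<Sum>i=1..n. \<Sum>j\<in>{i<..n}. of_bool (\<sigma> j < \<sigma> i))"
proof -
  have "{(i, j). 1 \<le> i \<and> i < j \<and> j \<le> n \<and> \<sigma> i > \<sigma> j} = (SIGMA i:{1..n}. {j\<in>{i<..n}. \<sigma> j < \<sigma> i})"
    by auto
  then have "occ21 n \<sigma> = (\<Sum>i=1..n. card {j\<in>{i<..n}. \<sigma> j < \<sigma> i})"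
    unfolding occ21_def by (subst card_SigmaI[symmetric]) auto
  then show ?thesis
    by (simp add: sum_of_bool_eq Int_def)
qed

text \<open>
  The clocks ring in the order prescribed by \<open>\<sigma>\<close>, where \<open>\<sigma> i\<close> is the rank of clock \<open>i\<close>. The leading \<open>0\<close>
  makes the event an instance of \<open>nn_integral_race\<close>.
\<close>

definition race_order :: "nat \<Rightarrow> (nat \<Rightarrow> nat) \<Rightarrow> (nat \<Rightarrow> real) \<Rightarrow> bool" where
  "race_order n \<sigma> X \<longleftrightarrow> sorted_wrt (<) (0 # map X (map (inv \<sigma>) [1..<Suc n]))"

lemma permutes_inv_upt:
  assumes "\<sigma> permutes {1..n}"
  shows "set (map (inv \<sigma>) [1..<Suc n]) = {1..n}" "distinct (map (inv \<sigma>) [1..<Suc n])"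
proof -
  have "inv \<sigma> permutes {1..n}" using assms by (rule permutes_inv)
  moreover have "set [1..<Suc n] = {1..n}" by auto
  ultimately show "set (map (inv \<sigma>) [1..<Suc n]) = {1..n}" "distinct (map (inv \<sigma>) [1..<Suc n])"
    by (simp_all only: set_map permutes_image distinct_map distinct_upt permutes_inj_on simp_thms)
qed

lemma race_order_iff:
  assumes \<sigma>: "\<sigma> permutes {1..n}" and X: "race_order n \<sigma> X" and i: "i \<in> {1..n}" and j: "j \<in> {1..n}"
  shows "X j < X i \<longleftrightarrow> \<sigma> j < \<sigma> i"
proof -
  have less: "X i < X j" if "\<sigma> i < \<sigma> j" "i \<in> {1..n}" "j \<in> {1..n}" for i j
  proof -
    have s: "sorted_wrt (<) (map (X \<circ> inv \<sigma>) [1..<Suc n])"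
      using X by (simp add: race_order_def del: upt_Suc)
    have r: "\<sigma> i \<in> {1..n}" "\<sigma> j \<in> {1..n}"
      using that permutes_in_image[OF \<sigma>] by auto
    have nth: "map (X \<circ> inv \<sigma>) [1..<Suc n] ! (k - 1) = X (inv \<sigma> k)" if "k \<in> {1..n}" for k
    proof -
      have "k - 1 < Suc n - 1" "1 + (k - 1) = k" using that by auto
      then show ?thesis using nth_map_upt[of "k - 1" "Suc n" 1 "X \<circ> inv \<sigma>"] by (simp only: comp_def)
    qed
    have "map (X \<circ> inv \<sigma>) [1..<Suc n] ! (\<sigma> i - 1) < map (X \<circ> inv \<sigma>) [1..<Suc n] ! (\<sigma> j - 1)"
      by (rule sorted_wrt_nth_less[OF s]) (use that(1) r in auto)
    then show ?thesis
      unfolding nth[OF r(1)] nth[OF r(2)] permutes_inverses(2)[OF \<sigma>] .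
  qed
  show ?thesis
    using less[OF _ j i] less[OF _ i j] permutes_inj[OF \<sigma>] by (metis inj_eq less_asym linorder_less_linear)
qed

lemma clock_inversions_race_order:
  assumes "\<sigma> permutes {1..n}" "race_order n \<sigma> X"
  shows "clock_inversions n X = real (occ21 n \<sigma>)"
  unfolding clock_inversions_def occ21_eq_sum
  by (intro sum.cong refl) (use race_order_iff[OF assms] in auto)

lemma race_order_unique:
  assumes \<sigma>: "\<sigma> permutes {1..n}" and \<tau>: "\<tau> permutes {1..n}"
    and "race_order n \<sigma> X" "race_order n \<tau> X"
  shows "\<sigma> = \<tau>"
proof -
  have s: "sorted_wrt (<) (map X (map (inv \<sigma>) [1..<Suc n]))" "sorted_wrt (<) (map X (map (inv \<tau>) [1..<Suc n]))"
    using assms(3,4) by (simp_all add: race_order_def del: upt_Suc)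
  have set: "set (map X (map (inv \<sigma>) [1..<Suc n])) = X ` {1..n}" "set (map X (map (inv \<tau>) [1..<Suc n])) = X ` {1..n}"
    using permutes_inv_upt(1)[OF \<sigma>] permutes_inv_upt(1)[OF \<tau>] by (simp_all only: set_map[of X])
  have eq: "map X (map (inv \<sigma>) [1..<Suc n]) = map X (map (inv \<tau>) [1..<Suc n])"
    using strict_sorted_equal[OF s] set by metis
  have "inj_on X {1..n}"
  proof (rule inj_onI)
    fix i j assume "i \<in> {1..n}" "j \<in> {1..n}" "X i = X j"
    then show "i = j"
      using race_order_iff[OF \<sigma> assms(3), of i j] race_order_iff[OF \<sigma> assms(3), of j i]
        permutes_inj[OF \<sigma>] by (metis inj_eq less_irrefl linorder_less_linear)
  qed
  then have "map (inv \<sigma>) [1..<Suc n] = map (inv \<tau>) [1..<Suc n]"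
    using eq permutes_inv_upt(1)[OF \<sigma>] permutes_inv_upt(1)[OF \<tau>]
    by (intro map_inj_on[OF eq]) (simp only: Un_absorb)
  then have "inv \<sigma> i = inv \<tau> i" if "i \<in> {1..n}" for i
    using that unfolding map_eq_conv set_upt by (auto simp: less_Suc_eq_le)
  moreover have "inv \<sigma> i = inv \<tau> i" if "i \<notin> {1..n}" for i
    using that permutes_not_in[OF permutes_inv[OF \<sigma>]] permutes_not_in[OF permutes_inv[OF \<tau>]] by simp
  ultimately have "inv \<sigma> = inv \<tau>" by blast
  then show ?thesis
    using permutes_inv_inv[OF \<sigma>] permutes_inv_inv[OF \<tau>] by metis
qed

lemma clock_inversions_measurable [measurable]:
  "clock_inversions n \<in> borel_measurable (Pi\<^sub>M {1..n} (\<lambda>i. exp_law (\<theta> i)))"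
  unfolding clock_inversions_def[abs_def]
proof (intro borel_measurable_sum)
  fix i j assume "i \<in> {1..n}" "j \<in> {i<..n}"
  then have [measurable]: "(\<lambda>X. X i) \<in> borel_measurable (Pi\<^sub>M {1..n} (\<lambda>i. exp_law (\<theta> i)))"
    "(\<lambda>X. X j) \<in> borel_measurable (Pi\<^sub>M {1..n} (\<lambda>i. exp_law (\<theta> i)))"
    by (auto intro!: measurable_clock)
  show "(\<lambda>X. of_bool (X j < X i)) \<in> borel_measurable (Pi\<^sub>M {1..n} (\<lambda>i. exp_law (\<theta> i)))"
    by measurable
qed

text \<open>
  The events \<open>race_order n \<sigma>\<close> are disjoint, have the Luce probabilities, and determine the number of
  inversions. Summing over permutations gives one inequality between the two laws for every Borel set;
  applied to the complement it becomes an equality, since both laws have total mass \<open>1\<close>. This also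
  disposes of ties.
\<close>

theorem luce_inversions_law:
  assumes \<theta>: "\<And>i. 0 < \<theta> i" and law: "luce_distributed n \<theta> P"
  shows "distr (measure_pmf P) borel (\<lambda>\<sigma>. real (occ21 n \<sigma>)) =
    distr (Pi\<^sub>M {1..n} (\<lambda>i. exp_law (\<theta> i))) borel (clock_inversions n)"
proof -
  interpret exponential_clocks "{1..n}" \<theta> by standard (use \<theta> in auto)
  let ?M = "Pi\<^sub>M {1..n} (\<lambda>i. exp_law (\<theta> i))"
  let ?A = "\<lambda>\<sigma>. {X \<in> space ?M. race_order n \<sigma> X}"
  have A_sets: "?A \<sigma> \<in> sets ?M" and A_meas: "measure ?M (?A \<sigma>) = pmf P \<sigma>" if \<sigma>: "\<sigma> permutes {1..n}" for \<sigma>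
  proof -
    note xs = permutes_inv_upt[OF \<sigma>]
    have pred: "Measurable.pred ?M (race_order n \<sigma>)"
      unfolding race_order_def[abs_def] by (rule race_measurable) (simp only: xs order_refl)
    then show sets: "?A \<sigma> \<in> sets ?M" by simp
    have "emeasure ?M (?A \<sigma>) = (\<integral>\<^sup>+X. indicator (?A \<sigma>) X \<partial>?M)"
      using sets by simp
    also have "\<dots> = (\<integral>\<^sup>+X. of_bool (race_order n \<sigma> X) \<partial>?M)"
      by (intro nn_integral_cong) (auto simp: indicator_def)
    also have "\<dots> = ennreal (race_weight \<theta> (map (inv \<sigma>) [1..<Suc n]))"
      using nn_integral_race[OF \<theta> xs(2), of 0] unfolding xs(1) race_order_def by simp
    also have "\<dots> = ennreal (pmf P \<sigma>)"
      using law \<sigma> by (simp only: luce_distributed_def luce_weight_eq_race_weight)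
    finally show "measure ?M (?A \<sigma>) = pmf P \<sigma>"
      by (simp add: measure_def)
  qed
  have le: "measure_pmf.prob P {\<sigma>. real (occ21 n \<sigma>) \<in> B} \<le> measure ?M {X \<in> space ?M. clock_inversions n X \<in> B}"
    if B: "B \<in> sets borel" for B
  proof -
    let ?Q = "{\<sigma>. \<sigma> permutes {1..n} \<and> real (occ21 n \<sigma>) \<in> B}"
    have fin: "finite ?Q" using finite_permutations[of "{1..n}"] by auto
    have "measure_pmf.prob P {\<sigma>. real (occ21 n \<sigma>) \<in> B} = measure_pmf.prob P ?Q"
      using law by (intro measure_pmf.finite_measure_eq_AE) (auto simp: AE_measure_pmf_iff luce_distributed_def)
    also have "\<dots> = (\<Sum>\<sigma>\<in>?Q. measure ?M (?A \<sigma>))"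
      using fin A_meas by (simp add: measure_measure_pmf_finite)
    also have "\<dots> = measure ?M (\<Union>\<sigma>\<in>?Q. ?A \<sigma>)"
    proof (rule P.finite_measure_finite_Union[symmetric, OF fin])
      show "disjoint_family_on ?A ?Q"
        unfolding disjoint_family_on_def using race_order_unique by blast
    qed (use A_sets in auto)
    also have "\<dots> \<le> measure ?M {X \<in> space ?M. clock_inversions n X \<in> B}"
    proof (rule P.finite_measure_mono)
      show "{X \<in> space ?M. clock_inversions n X \<in> B} \<in> sets ?M"
        using B by measurable
    qed (auto simp: clock_inversions_race_order)
    finally show ?thesis .
  qed
  have eq: "measure_pmf.prob P {\<sigma>. real (occ21 n \<sigma>) \<in> B} = measure ?M {X \<in> space ?M. clock_inversions n X \<in> B}"
    if B: "B \<in> sets borel" for B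
  proof -
    have "measure_pmf.prob P {\<sigma>. real (occ21 n \<sigma>) \<in> - B} = 1 - measure_pmf.prob P {\<sigma>. real (occ21 n \<sigma>) \<in> B}"
      using measure_pmf.prob_compl[of "{\<sigma>. real (occ21 n \<sigma>) \<in> B}" P]
      by (simp add: Compl_eq_Diff_UNIV set_diff_eq)
    moreover have "measure ?M {X \<in> space ?M. clock_inversions n X \<in> - B} = 1 - measure ?M {X \<in> space ?M. clock_inversions n X \<in> B}"
    proof -
      have "{X \<in> space ?M. clock_inversions n X \<in> B} \<in> sets ?M" using B by measurable
      from P.prob_neg[OF this] show ?thesis
        by (simp only: Compl_iff)
    qed
    moreover have "- B \<in> sets borel" using B by (simp add: Compl_eq_Diff_UNIV)
    ultimately show ?thesis
      using le[OF B] le[of "- B"] by linarith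
  qed
  show ?thesis
  proof (rule measure_eqI)
    fix B assume "B \<in> sets (distr (measure_pmf P) borel (\<lambda>\<sigma>. real (occ21 n \<sigma>)))"
    then have B: "B \<in> sets borel" by simp
    have "emeasure (distr (measure_pmf P) borel (\<lambda>\<sigma>. real (occ21 n \<sigma>))) B
        = emeasure (measure_pmf P) {\<sigma>. real (occ21 n \<sigma>) \<in> B}"
      using B by (subst emeasure_distr) (auto simp: vimage_def)
    also have "\<dots> = emeasure ?M {X \<in> space ?M. clock_inversions n X \<in> B}"
      unfolding measure_pmf.emeasure_eq_measure P.emeasure_eq_measure eq[OF B] ..
    also have "{X \<in> space ?M. clock_inversions n X \<in> B} = clock_inversions n -` B \<inter> space ?M"
      by auto
    also have "emeasure ?M \<dots> = emeasure (distr ?M borel (clock_inversions n)) B"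
      by (rule emeasure_distr[OF clock_inversions_measurable B, symmetric])
    finally show "emeasure (distr (measure_pmf P) borel (\<lambda>\<sigma>. real (occ21 n \<sigma>))) B =
        emeasure (distr ?M borel (clock_inversions n)) B" .
  qed simp
qed

section \<open>Symmetric sums over pairs and triples\<close>

lemma greaterThanAtMost_Suc: "i \<le> n \<Longrightarrow> {i<..Suc n} = insert (Suc n) {i<..n}"
  by auto

lemma sum_pairs_increasing_Suc:
  fixes H :: "nat \<Rightarrow> nat \<Rightarrow> real"
  shows "(\<Sum>i=1..Suc n. \<Sum>j\<in>{i<..Suc n}. H i j) = (\<Sum>i=1..n. \<Sum>j\<in>{i<..n}. H i j) + (\<Sum>i=1..n. H i (Suc n))"
proof -
  have "(\<Sum>i=1..n. \<Sum>j\<in>{i<..Suc n}. H i j) = (\<Sum>i=1..n. (\<Sum>j\<in>{i<..n}. H i j) + H i (Suc n))"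
    by (intro sum.cong refl) (simp add: greaterThanAtMost_Suc)
  then show ?thesis by (simp add: sum.distrib)
qed

lemma sum_triples_increasing_Suc:
  fixes H :: "nat \<Rightarrow> nat \<Rightarrow> nat \<Rightarrow> real"
  shows "(\<Sum>i=1..Suc n. \<Sum>j\<in>{i<..Suc n}. \<Sum>k\<in>{j<..Suc n}. H i j k) =
    (\<Sum>i=1..n. \<Sum>j\<in>{i<..n}. \<Sum>k\<in>{j<..n}. H i j k) + (\<Sum>i=1..n. \<Sum>j\<in>{i<..n}. H i j (Suc n))"
proof -
  have "(\<Sum>i=1..n. \<Sum>j\<in>{i<..n}. \<Sum>k\<in>{j<..Suc n}. H i j k) =
      (\<Sum>i=1..n. \<Sum>j\<in>{i<..n}. (\<Sum>k\<in>{j<..n}. H i j k) + H i j (Suc n))"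
    by (intro sum.cong refl) (simp add: greaterThanAtMost_Suc)
  then show ?thesis
    unfolding sum_pairs_increasing_Suc by (simp add: sum.distrib)
qed

lemma sum_square_symmetric:
  fixes G :: "nat \<Rightarrow> nat \<Rightarrow> real"
  shows "(\<Sum>i=1..n. \<Sum>j=1..n. G i j) = (\<Sum>i=1..n. G i i) + (\<Sum>i=1..n. \<Sum>j\<in>{i<..n}. G i j + G j i)"
proof (induction n)
  case (Suc n)
  then show ?case
    unfolding sum_pairs_increasing_Suc by (simp add: sum.distrib)
qed simp

text \<open>
  The first index plays the role of the clock that two pairs of clocks share. The terms are grouped by
  the set of indices that occur, and the induction on \<open>n\<close> separates the terms in which \<open>n\<close> occurs.
\<close>

lemma sum_cube_symmetric:
  fixes F :: "nat \<Rightarrow> nat \<Rightarrow> nat \<Rightarrow> real"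
  assumes sym: "\<And>i j k. F i j k = F i k j" and diag: "\<And>i j. F i i j = 0"
  shows "(\<Sum>i=1..n. \<Sum>j=1..n. \<Sum>k=1..n. F i j k) =
    (\<Sum>i=1..n. \<Sum>j\<in>{i<..n}. F i j j + F j i i) +
    2 * (\<Sum>i=1..n. \<Sum>j\<in>{i<..n}. \<Sum>k\<in>{j<..n}. F i j k + F j i k + F k i j)"
proof (induction n)
  case (Suc n)
  let ?m = "Suc n"
  have diag': "F i j i = 0" for i j using sym diag by metis
  have last: "(\<Sum>j=1..n. \<Sum>k=1..n. F ?m j k) = (\<Sum>j=1..n. F ?m j j) + 2 * (\<Sum>i=1..n. \<Sum>j\<in>{i<..n}. F ?m i j)"
  proof -
    have "F ?m i j + F ?m j i = 2 * F ?m i j" for i j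
      using sym[of ?m j i] by simp
    then show ?thesis
      unfolding sum_square_symmetric[of "F ?m"] by (simp add: sum_distrib_left)
  qed
  have mid: "(\<Sum>i=1..n. \<Sum>j=1..n. F i j ?m) = (\<Sum>i=1..n. \<Sum>j\<in>{i<..n}. F i j ?m + F j i ?m)"
    unfolding sum_square_symmetric[of "\<lambda>i j. F i j ?m"] by (simp add: diag)
  have flip: "(\<Sum>k=1..n. F i ?m k) = (\<Sum>k=1..n. F i k ?m)" for i
    by (intro sum.cong refl sym)
  have "(\<Sum>i=1..?m. \<Sum>j=1..?m. \<Sum>k=1..?m. F i j k) =
      (\<Sum>i=1..n. \<Sum>j=1..n. \<Sum>k=1..n. F i j k) + 2 * (\<Sum>i=1..n. \<Sum>j=1..n. F i j ?m)
      + (\<Sum>i=1..n. F i ?m ?m) + (\<Sum>j=1..n. \<Sum>k=1..n. F ?m j k)"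
    by (simp add: sum.distrib diag diag' flip[unfolded One_nat_def]) (simp add: sum_distrib_left)
  also have "\<dots> = (\<Sum>i=1..?m. \<Sum>j\<in>{i<..?m}. F i j j + F j i i) +
      2 * (\<Sum>i=1..?m. \<Sum>j\<in>{i<..?m}. \<Sum>k\<in>{j<..?m}. F i j k + F j i k + F k i j)"
    unfolding Suc.IH last mid sum_triples_increasing_Suc
    unfolding sum_pairs_increasing_Suc by (simp add: sum.distrib)
  finally show ?case .
qed simp

section \<open>Hoeffding decomposition of a single inversion\<close>

context exponential_clocks
begin

abbreviation "clocks \<equiv> Pi\<^sub>M I (\<lambda>i. exp_law (\<theta> i))"

lemma clock_measurable [measurable]: "i \<in> I \<Longrightarrow> (\<lambda>X. X i) \<in> borel_measurable clocks"
  by (rule measurable_clock)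

text \<open>
  Fubini's theorem in the form from which all orthogonality relations below follow.
\<close>

lemma integral_zero_if_fibers_zero:
  fixes f :: "(nat \<Rightarrow> real) \<Rightarrow> real"
  assumes i: "i \<in> I" and f: "f \<in> borel_measurable clocks" and bnd: "\<And>X. \<bar>f X\<bar> \<le> K"
    and zero: "\<And>X. (\<integral>x. f (X(i := x)) \<partial>\<mu> i) = 0"
  shows "(\<integral>X. f X \<partial>clocks) = 0"
proof -
  define J where "J = I - {i}"
  have J: "finite J" "i \<notin> J" "insert i J = I" using i finite_I by (auto simp: J_def)
  have "integrable clocks f"
    by (rule P.integrable_const_bound[of _ K]) (use bnd f in auto)
  then have "(\<integral>X. f X \<partial>Pi\<^sub>M (insert i J) \<mu>) = (\<integral>X. (\<integral>x. f (X(i := x)) \<partial>\<mu> i) \<partial>Pi\<^sub>M J \<mu>)"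
    using J by (intro product_integral_insert) auto
  then show ?thesis by (simp add: zero J)
qed

lemma integral_coordinate:
  fixes g :: "real \<Rightarrow> real"
  assumes i: "i \<in> I" and g: "g \<in> borel_measurable borel"
  shows "(\<integral>X. g (X i) \<partial>clocks) = (\<integral>x. g x \<partial>\<mu> i)"
proof -
  have "(\<integral>x. g x \<partial>\<mu> i) = (\<integral>x. g x \<partial>distr clocks (\<mu> i) (\<lambda>X. X i))"
    by (subst distr_PiM_component[OF prob_space_exp_law[OF \<theta>_pos] i]) simp
  also have "\<dots> = (\<integral>X. g (X i) \<partial>clocks)"
    by (rule integral_distr) (use i g in auto)
  finally show ?thesis ..
qed

text \<open>
  The probability that clock \<open>j\<close> rings after \<open>x\<close>, centred under the law of clock \<open>i\<close>.
\<close>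

definition dev :: "nat \<Rightarrow> nat \<Rightarrow> real \<Rightarrow> real" where
  "dev i j x = exp_tail (\<theta> j) x - \<theta> i / (\<theta> i + \<theta> j)"

text \<open>
  The degenerate part of the indicator that \<open>j\<close> rings before \<open>i\<close>. Its conditional expectation given either
  of the two clocks is zero.
\<close>

definition rem :: "nat \<Rightarrow> nat \<Rightarrow> (nat \<Rightarrow> real) \<Rightarrow> real" where
  "rem i j X = of_bool (X j < X i) - \<theta> j / (\<theta> i + \<theta> j) + dev i j (X i) - dev j i (X j)"

lemma dev_measurable [measurable]: "dev i j \<in> borel_measurable borel"
  unfolding dev_def by measurable

lemma rem_measurable [measurable]: "i \<in> I \<Longrightarrow> j \<in> I \<Longrightarrow> rem i j \<in> borel_measurable clocks"
  unfolding rem_def by measurable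

lemma ratio_bounds: "0 \<le> \<theta> i / (\<theta> i + \<theta> j)" "\<theta> i / (\<theta> i + \<theta> j) \<le> 1"
  using \<theta>_pos[of i] \<theta>_pos[of j] by (auto simp: field_simps)

lemma dev_bound: "\<bar>dev i j x\<bar> \<le> 1"
  using exp_tail_bounds[of "\<theta> j" x] \<theta>_pos[of j] ratio_bounds[of i j] by (auto simp: dev_def abs_le_iff)

lemma rem_bound: "\<bar>rem i j X\<bar> \<le> 4"
  using dev_bound[of i j "X i"] dev_bound[of j i "X j"] ratio_bounds[of j i]
  by (auto simp: rem_def abs_le_iff of_bool_def add.commute)

lemma integrable_exp_tail: "integrable (\<mu> i) (exp_tail (\<theta> j))"
  by (rule M.integrable_const_bound[of _ 1]) (use exp_tail_bounds[of "\<theta> j"] \<theta>_pos[of j] in auto)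

lemma integrable_dev: "integrable (\<mu> i) (dev j k)"
  by (rule M.integrable_const_bound[of _ 1]) (use dev_bound in auto)

lemma integral_dev: "(\<integral>x. dev i j x \<partial>\<mu> i) = 0"
  using integrable_exp_tail[of i j] \<theta>_pos[of i] \<theta>_pos[of j]
  by (simp add: dev_def integral_exp_tail M.prob_space)

text \<open>
  The covariance of \<open>dev i j\<close> and \<open>dev i k\<close> under the law of clock \<open>i\<close>, brought to a common
  denominator.
\<close>

definition dev_cov :: "nat \<Rightarrow> nat \<Rightarrow> nat \<Rightarrow> real" where
  "dev_cov i j k = \<theta> i * \<theta> j * \<theta> k / ((\<theta> i + \<theta> j + \<theta> k) * (\<theta> i + \<theta> j) * (\<theta> i + \<theta> k))"

lemma integral_dev_mult: "(\<integral>x. dev i j x * dev i k x \<partial>\<mu> i) = dev_cov i j k"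
proof -
  let ?a = "\<theta> i / (\<theta> i + \<theta> j)" and ?b = "\<theta> i / (\<theta> i + \<theta> k)"
  have pos: "0 < \<theta> i" "0 < \<theta> j" "0 < \<theta> k" by (auto simp: \<theta>_pos)
  have int: "integrable (\<mu> i) (exp_tail (\<theta> j + \<theta> k))"
    by (rule M.integrable_const_bound[of _ 1]) (use exp_tail_bounds[of "\<theta> j + \<theta> k"] pos in auto)
  have "(\<integral>x. dev i j x * dev i k x \<partial>\<mu> i) =
      (\<integral>x. exp_tail (\<theta> j + \<theta> k) x - ?b * exp_tail (\<theta> j) x - ?a * exp_tail (\<theta> k) x + ?a * ?b \<partial>\<mu> i)"
    by (intro Bochner_Integration.integral_cong) (simp_all add: dev_def algebra_simps flip: exp_tail_mult)
  also have "\<dots> = \<theta> i / (\<theta> i + (\<theta> j + \<theta> k)) - ?b * ?a - ?a * ?b + ?a * ?b"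
    using int integrable_exp_tail[of i j] integrable_exp_tail[of i k] pos
    by (simp add: integral_exp_tail M.prob_space)
  also have "\<dots> = dev_cov i j k"
  proof -
    have "\<theta> i + \<theta> j \<noteq> 0" "\<theta> i + \<theta> k \<noteq> 0" "\<theta> i + (\<theta> j + \<theta> k) \<noteq> 0" using pos by auto
    then show ?thesis unfolding dev_cov_def add.assoc by (simp add: divide_simps) (simp add: algebra_simps)
  qed
  finally show ?thesis .
qed

lemma integral_rem_fst:
  assumes "i \<noteq> j"
  shows "(\<integral>x. rem i j (X(i := x)) \<partial>\<mu> i) = 0"
proof -
  have "(\<integral>x. of_bool (X j < x) \<partial>\<mu> i) = measure (\<mu> i) {X j<..}"
    by (subst M.expectation_of_bool) (auto intro!: arg_cong[of _ _ "measure _"])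
  also have "\<dots> = exp_tail (\<theta> i) (X j)"
    by (rule measure_exp_law_greaterThan) (rule \<theta>_pos)
  finally have *: "(\<integral>x. of_bool (X j < x) \<partial>\<mu> i) = exp_tail (\<theta> i) (X j)" .
  have int: "integrable (\<mu> i) (\<lambda>x. of_bool (X j < x) :: real)"
    by (rule M.integrable_const_bound[of _ 1]) auto
  show ?thesis
    using assms int integrable_dev[of i i j] 
    by (simp add: rem_def * integral_dev M.prob_space) (simp add: dev_def add.commute)
qed

lemma integral_rem_snd:
  assumes "i \<noteq> j"
  shows "(\<integral>x. rem i j (X(j := x)) \<partial>\<mu> j) = 0"
proof -
  have "(\<integral>x. of_bool (x < X i) \<partial>\<mu> j) = measure (\<mu> j) {..<X i}"
    by (subst M.expectation_of_bool) (auto intro!: arg_cong[of _ _ "measure _"])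
  also have "\<dots> = 1 - exp_tail (\<theta> j) (X i)"
    by (rule measure_exp_law_lessThan) (rule \<theta>_pos)
  finally have *: "(\<integral>x. of_bool (x < X i) \<partial>\<mu> j) = 1 - exp_tail (\<theta> j) (X i)" .
  have int: "integrable (\<mu> j) (\<lambda>x. of_bool (x < X i) :: real)"
    by (rule M.integrable_const_bound[of _ 1]) auto
  have "\<theta> i / (\<theta> i + \<theta> j) + \<theta> j / (\<theta> i + \<theta> j) = 1"
    using \<theta>_pos[of i] \<theta>_pos[of j] by (simp flip: add_divide_distrib)
  then show ?thesis
    using assms int integrable_dev[of j j i]
    by (simp add: rem_def * integral_dev M.prob_space) (simp add: dev_def)
qed

lemma dev_orthogonal:
  assumes "i \<in> I" "j \<in> I" "i \<noteq> j"
  shows "(\<integral>X. dev i k (X i) * dev j l (X j) \<partial>clocks) = 0"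
proof (rule integral_zero_if_fibers_zero[OF \<open>i \<in> I\<close>])
  show "\<bar>dev i k (X i) * dev j l (X j)\<bar> \<le> 1 * 1" for X
    unfolding abs_mult by (intro mult_mono dev_bound) auto
  show "(\<integral>x. dev i k ((X(i := x)) i) * dev j l ((X(i := x)) j) \<partial>\<mu> i) = 0" for X
    using assms by (simp add: integral_dev)
qed (use assms in measurable)

text \<open>
  At least one of the clocks \<open>i\<close> and \<open>j\<close> is not \<open>k\<close>; integrating over it first gives zero.
\<close>

lemma dev_rem_orthogonal:
  assumes "i \<in> I" "j \<in> I" "k \<in> I" "i \<noteq> j"
  shows "(\<integral>X. dev k l (X k) * rem i j X \<partial>clocks) = 0"
proof -
  have bnd: "\<bar>dev k l (X k) * rem i j X\<bar> \<le> 1 * 4" for X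
    unfolding abs_mult by (intro mult_mono dev_bound rem_bound) auto
  have meas: "(\<lambda>X. dev k l (X k) * rem i j X) \<in> borel_measurable clocks"
    using assms by measurable
  show ?thesis
  proof (cases "k = i")
    case True
    have "(\<integral>x. dev k l ((X(j := x)) k) * rem i j (X(j := x)) \<partial>\<mu> j) = 0" for X
    proof -
      have "(X(j := x)) k = X k" for x using True assms(4) by simp
      then show ?thesis
        by (simp only: integral_mult_right_zero integral_rem_snd[OF assms(4)] mult_zero_right)
    qed
    then show ?thesis
      by (rule integral_zero_if_fibers_zero[OF \<open>j \<in> I\<close> meas bnd])
  next
    case False
    have "(\<integral>x. dev k l ((X(i := x)) k) * rem i j (X(i := x)) \<partial>\<mu> i) = 0" for X
    proof -
      have "(X(i := x)) k = X k" for x using False assms(4) by simp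
      then show ?thesis
        by (simp only: integral_mult_right_zero integral_rem_fst[OF assms(4)] mult_zero_right)
    qed
    then show ?thesis
      by (rule integral_zero_if_fibers_zero[OF \<open>i \<in> I\<close> meas bnd])
  qed
qed

text \<open>
  Two different increasing pairs are different as sets, so the first has a clock that does not occur in the
  second; integrating over it first gives zero.
\<close>

lemma rem_orthogonal:
  assumes "i \<in> I" "j \<in> I" "k \<in> I" "l \<in> I" "i < j" "k < l" "(i, j) \<noteq> (k, l)"
  shows "(\<integral>X. rem i j X * rem k l X \<partial>clocks) = 0"
proof -
  have bnd: "\<bar>rem i j X * rem k l X\<bar> \<le> 4 * 4" for X
    unfolding abs_mult by (intro mult_mono rem_bound) auto
  have meas: "(\<lambda>X. rem i j X * rem k l X) \<in> borel_measurable clocks"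
    using assms by measurable
  have const: "rem k l (X(m := x)) = rem k l X" if "m \<noteq> k" "m \<noteq> l" for X m x
    using that by (simp add: rem_def)
  show ?thesis
  proof (cases "i = k \<or> i = l")
    case True
    then have "j \<noteq> k" "j \<noteq> l" using assms by auto
    show ?thesis
      by (rule integral_zero_if_fibers_zero[OF \<open>j \<in> I\<close> meas bnd])
         (use assms const[OF \<open>j \<noteq> k\<close> \<open>j \<noteq> l\<close>] in \<open>simp add: integral_rem_snd\<close>)
  next
    case False
    then have "i \<noteq> k" "i \<noteq> l" by auto
    show ?thesis
      by (rule integral_zero_if_fibers_zero[OF \<open>i \<in> I\<close> meas bnd])
         (use assms const[OF \<open>i \<noteq> k\<close> \<open>i \<noteq> l\<close>] in \<open>simp add: integral_rem_fst\<close>)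
  qed
qed

lemma indep_vars_clocks:
  assumes "I \<noteq> {}"
  shows "P.indep_vars (\<lambda>_. borel) (\<lambda>i X. X i) I"
proof -
  have law: "distr clocks borel (\<lambda>X. X i) = \<mu> i" if "i \<in> I" for i
    using distr_PiM_component[of I \<mu>, OF prob_space_exp_law[OF \<theta>_pos] that]
    by (simp cong: distr_cong)
  have "distr clocks (\<Pi>\<^sub>M i\<in>I. borel) (\<lambda>X. \<lambda>i\<in>I. X i) = distr clocks clocks (\<lambda>X. X)"
    by (rule distr_cong) (auto intro!: sets_PiM_cong simp: space_PiM restrict_PiE_iff extensional_restrict PiE_iff)
  also have "\<dots> = (\<Pi>\<^sub>M i\<in>I. distr clocks borel (\<lambda>X. X i))"
    unfolding distr_id2[OF refl] by (intro PiM_cong refl) (simp add: law)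
  finally show ?thesis
    by (subst P.indep_vars_iff_distr_eq_PiM'[OF assms]) auto
qed

end

section \<open>Mean and variance of the number of inversions\<close>

locale luce_clocks =
  fixes n :: nat and \<theta> :: "nat \<Rightarrow> real"
  assumes n_pos: "1 \<le> n" and weight_pos: "\<And>i. 0 < \<theta> i"
begin

declare One_nat_def [simp del]

sublocale exponential_clocks "{1..n}" \<theta>
  by unfold_locales (auto simp: weight_pos)

lemma integrable_bounded:
  fixes f :: "(nat \<Rightarrow> real) \<Rightarrow> real"
  shows "f \<in> borel_measurable clocks \<Longrightarrow> (\<And>X. \<bar>f X\<bar> \<le> K) \<Longrightarrow> integrable clocks f"
  by (rule P.integrable_const_bound[of _ K]) auto

lemma integrable_bounded_mult:
  fixes f g :: "(nat \<Rightarrow> real) \<Rightarrow> real"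
  assumes "f \<in> borel_measurable clocks" "g \<in> borel_measurable clocks"
    and f: "\<And>X. \<bar>f X\<bar> \<le> K" and g: "\<And>X. \<bar>g X\<bar> \<le> L"
  shows "integrable clocks (\<lambda>X. f X * g X)"
proof (rule integrable_bounded[of _ "K * L"])
  have "0 \<le> K" using abs_ge_zero f by (rule order_trans)
  then show "\<bar>f X * g X\<bar> \<le> K * L" for X
    unfolding abs_mult using f g by (intro mult_mono abs_ge_zero)
qed (use assms in measurable)

text \<open>
  Clock \<open>i\<close> enters the linear part of an inversion with \<open>j\<close> negatively if \<open>i < j\<close> and positively if
  \<open>j < i\<close>.
\<close>

definition order_sign :: "nat \<Rightarrow> nat \<Rightarrow> real" where
  "order_sign i j = (if j < i then 1 else if i < j then - 1 else 0)"

text \<open>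
  The contribution of clock \<open>i\<close> to the Hajek projection, the best approximation of the centred number of
  inversions by a sum of functions of single clocks.
\<close>

definition hajek :: "nat \<Rightarrow> real \<Rightarrow> real" where
  "hajek i x = (\<Sum>j=1..n. order_sign i j * dev i j x)"

definition projection :: "(nat \<Rightarrow> real) \<Rightarrow> real" where
  "projection X = (\<Sum>i=1..n. hajek i (X i))"

definition remainder :: "(nat \<Rightarrow> real) \<Rightarrow> real" where
  "remainder X = (\<Sum>i=1..n. \<Sum>j\<in>{i<..n}. rem i j X)"

definition mean_inversions :: real where
  "mean_inversions = (\<Sum>i=1..n. \<Sum>j\<in>{i<..n}. \<theta> j / (\<theta> i + \<theta> j))"

lemma clock_inversions_decomposition:
  "clock_inversions n X = mean_inversions + projection X + remainder X"
proof -
  have "projection X = (\<Sum>i=1..n. \<Sum>j=1..n. order_sign i j * dev i j (X i))"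
    by (simp add: projection_def hajek_def)
  also have "\<dots> = (\<Sum>i=1..n. \<Sum>j\<in>{i<..n}. dev j i (X j) - dev i j (X i))"
    unfolding sum_square_symmetric[of "\<lambda>i j. order_sign i j * dev i j (X i)"]
    by (simp add: order_sign_def)
  finally show ?thesis
    unfolding clock_inversions_def mean_inversions_def remainder_def
    by (simp add: rem_def algebra_simps flip: sum.distrib)
qed

lemma hajek_measurable [measurable]: "hajek i \<in> borel_measurable borel"
  unfolding hajek_def[abs_def] by measurable

lemma hajek_bound: "\<bar>hajek i x\<bar> \<le> n"
proof -
  have "\<bar>order_sign i j * dev i j x\<bar> \<le> 1" for j
    using dev_bound[of i j x] by (simp add: order_sign_def)
  then have "\<bar>hajek i x\<bar> \<le> of_nat (card {1..n}) * 1"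
    unfolding hajek_def by (intro order_trans[OF sum_abs] sum_bounded_above) auto
  then show ?thesis by simp
qed

lemma projection_measurable [measurable]: "projection \<in> borel_measurable clocks"
proof -
  have "(\<lambda>X. hajek i (X i)) \<in> borel_measurable clocks" if "i \<in> {1..n}" for i
    using that by measurable
  then show ?thesis
    unfolding projection_def[abs_def] by (intro borel_measurable_sum)
qed

lemma remainder_measurable [measurable]: "remainder \<in> borel_measurable clocks"
  unfolding remainder_def[abs_def] by (intro borel_measurable_sum rem_measurable) auto

lemma projection_bound: "\<bar>projection X\<bar> \<le> real n * real n"
proof -
  have "\<bar>projection X\<bar> \<le> of_nat (card {1..n}) * real n"
    unfolding projection_def by (intro order_trans[OF sum_abs] sum_bounded_above hajek_bound)
  then show ?thesis by simp
qed

definition pairs :: "(nat \<times> nat) set" where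
  "pairs = (SIGMA i:{1..n}. {i<..n})"

lemma finite_pairs [simp]: "finite pairs"
  by (simp add: pairs_def)

lemma sum_pairs: "(\<Sum>i=1..n. \<Sum>j\<in>{i<..n}. f i j) = (\<Sum>(i, j)\<in>pairs. f i j)"
  unfolding pairs_def by (rule sum.Sigma) auto

lemma card_pairs_le: "card pairs \<le> n * n"
proof -
  have "pairs \<subseteq> {1..n} \<times> {1..n}" by (auto simp: pairs_def)
  then have "card pairs \<le> card ({1..n} \<times> {1..n})" by (intro card_mono) auto
  then show ?thesis by simp
qed

lemma remainder_eq_sum_pairs: "remainder X = (\<Sum>q\<in>pairs. rem (fst q) (snd q) X)"
  unfolding remainder_def sum_pairs by (simp add: case_prod_unfold)

lemma remainder_bound: "\<bar>remainder X\<bar> \<le> real (card pairs) * 4"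
  unfolding remainder_eq_sum_pairs by (intro order_trans[OF sum_abs] sum_bounded_above rem_bound)

lemma integrable_projection: "integrable clocks projection"
  by (rule integrable_bounded[OF projection_measurable projection_bound])

lemma integrable_remainder: "integrable clocks remainder"
  by (rule integrable_bounded[OF remainder_measurable remainder_bound])

lemma integrable_square_mult:
  "integrable clocks (\<lambda>X. (projection X)\<^sup>2)" "integrable clocks (\<lambda>X. (remainder X)\<^sup>2)"
  "integrable clocks (\<lambda>X. projection X * remainder X)"
  unfolding power2_eq_square
  by (rule integrable_bounded_mult[OF projection_measurable projection_measurable projection_bound projection_bound]
      integrable_bounded_mult[OF remainder_measurable remainder_measurable remainder_bound remainder_bound]
      integrable_bounded_mult[OF projection_measurable remainder_measurable projection_bound remainder_bound])+

lemma integral_hajek: "i \<in> {1..n} \<Longrightarrow> (\<integral>X. hajek i (X i) \<partial>clocks) = 0"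
  by (subst integral_coordinate) (simp_all add: hajek_def[abs_def] integrable_dev integral_dev)

lemma integral_projection: "(\<integral>X. projection X \<partial>clocks) = 0"
proof -
  have "integrable clocks (\<lambda>X. hajek i (X i))" if "i \<in> {1..n}" for i
    using that by (intro integrable_bounded[of _ "real n"] hajek_bound) measurable
  then show ?thesis
    unfolding projection_def by (subst Bochner_Integration.integral_sum) (auto simp: integral_hajek)
qed

lemma integral_rem:
  assumes "(i, j) \<in> pairs"
  shows "(\<integral>X. rem i j X \<partial>clocks) = 0"
  by (rule integral_zero_if_fibers_zero[of i, OF _ _ rem_bound integral_rem_fst])
     (use assms in \<open>auto simp: pairs_def intro!: rem_measurable\<close>)

lemma integrable_rem: "(i, j) \<in> pairs \<Longrightarrow> integrable clocks (rem i j)"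
  by (rule integrable_bounded[OF rem_measurable rem_bound]) (auto simp: pairs_def)

lemma integral_remainder: "(\<integral>X. remainder X \<partial>clocks) = 0"
  unfolding remainder_eq_sum_pairs
  by (subst Bochner_Integration.integral_sum) (auto simp: integral_rem integrable_rem)

lemma integral_clock_inversions: "(\<integral>X. clock_inversions n X \<partial>clocks) = mean_inversions"
  unfolding clock_inversions_decomposition
  using integrable_projection integrable_remainder
  by (simp add: integral_projection integral_remainder P.prob_space)

lemma integral_projection_remainder: "(\<integral>X. projection X * remainder X \<partial>clocks) = 0"
proof -
  have zero: "(\<integral>X. hajek k (X k) * rem i j X \<partial>clocks) = 0" if "k \<in> {1..n}" "(i, j) \<in> pairs" for i j k
  proof -
    have ij: "i \<in> {1..n}" "j \<in> {1..n}" "i \<noteq> j" using that by (auto simp: pairs_def)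
    have "integrable clocks (\<lambda>X. dev k l (X k) * rem i j X)" for l
      by (rule integrable_bounded_mult[OF _ _ dev_bound rem_bound]) (use that ij in measurable)
    then show ?thesis
      using dev_rem_orthogonal[OF ij(1,2) that(1) ij(3)]
      unfolding hajek_def sum_distrib_right mult.assoc
      by (subst Bochner_Integration.integral_sum) auto
  qed
  have int: "integrable clocks (\<lambda>X. hajek k (X k) * rem i j X)" if "k \<in> {1..n}" "(i, j) \<in> pairs" for i j k
  proof -
    have "i \<in> {1..n}" "j \<in> {1..n}" using that by (auto simp: pairs_def)
    then show ?thesis
      by (intro integrable_bounded_mult[OF _ _ hajek_bound rem_bound]) (use that in measurable)
  qed
  have "(\<integral>X. projection X * remainder X \<partial>clocks) =
      (\<integral>X. (\<Sum>k=1..n. \<Sum>q\<in>pairs. hajek k (X k) * rem (fst q) (snd q) X) \<partial>clocks)"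
    unfolding projection_def remainder_eq_sum_pairs sum_product ..
  also have "\<dots> = (\<Sum>k=1..n. \<Sum>q\<in>pairs. \<integral>X. hajek k (X k) * rem (fst q) (snd q) X \<partial>clocks)"
    using int by (simp add: Bochner_Integration.integral_sum)
  also have "\<dots> = 0"
    using zero by (intro sum.neutral ballI) auto
  finally show ?thesis .
qed

lemma indep_vars_hajek: "P.indep_vars (\<lambda>_. borel) (\<lambda>i X. c * hajek i (X i)) {1..n}"
  using indep_vars_clocks n_pos by (intro P.indep_vars_compose2[where Y = "\<lambda>i x. c * hajek i x"]) auto

lemma integral_projection_square:
  "(\<integral>X. (projection X)\<^sup>2 \<partial>clocks) =
    (\<Sum>i=1..n. \<Sum>j=1..n. \<Sum>k=1..n. order_sign i j * order_sign i k * dev_cov i j k)"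
proof -
  have sq: "(\<integral>X. (hajek i (X i))\<^sup>2 \<partial>clocks) =
      (\<Sum>j=1..n. \<Sum>k=1..n. order_sign i j * order_sign i k * dev_cov i j k)" if "i \<in> {1..n}" for i
  proof -
    have int: "integrable (\<mu> i) (\<lambda>x. dev i j x * dev i k x)" for j k
    proof (rule M.integrable_const_bound[of _ "1 * 1"])
      show "AE x in \<mu> i. norm (dev i j x * dev i k x) \<le> 1 * 1"
        unfolding real_norm_def abs_mult by (intro AE_I2 mult_mono dev_bound) auto
    qed auto
    have "(\<integral>X. (hajek i (X i))\<^sup>2 \<partial>clocks) = (\<integral>x. (hajek i x)\<^sup>2 \<partial>\<mu> i)"
      by (rule integral_coordinate[OF that]) measurable
    also have "\<dots> = (\<integral>x. (\<Sum>j=1..n. \<Sum>k=1..n. order_sign i j * order_sign i k * (dev i j x * dev i k x)) \<partial>\<mu> i)"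
      unfolding power2_eq_square hajek_def sum_product by (simp only: mult_ac)
    also have "\<dots> = (\<Sum>j=1..n. \<Sum>k=1..n. order_sign i j * order_sign i k * dev_cov i j k)"
      using int by (simp add: integral_dev_mult)
    finally show ?thesis .
  qed
  have "(\<integral>X. (projection X)\<^sup>2 \<partial>clocks) = (\<Sum>i=1..n. \<integral>X. (hajek i (X i))\<^sup>2 \<partial>clocks)"
    unfolding projection_def
  proof (rule P.variance_sum_indep)
    show "P.indep_vars (\<lambda>_. borel) (\<lambda>i X. hajek i (X i)) {1..n}"
      using indep_vars_hajek[of 1] by simp
  qed (use hajek_bound in \<open>auto simp: integral_hajek\<close>)
  then show ?thesis using sq by simp
qed

text \<open>
  Pythagoras for the decomposition of one indicator, whose variance is \<open>p (1 - p)\<close>.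
\<close>

lemma integral_rem_square:
  assumes "(i, j) \<in> pairs"
  shows "(\<integral>X. (rem i j X)\<^sup>2 \<partial>clocks) = \<theta> i * \<theta> j / (\<theta> i + \<theta> j)\<^sup>2 - dev_cov i j j - dev_cov j i i"
proof -
  have ij: "i \<in> {1..n}" "j \<in> {1..n}" "i \<noteq> j" using assms by (auto simp: pairs_def)
  let ?p = "\<theta> j / (\<theta> i + \<theta> j)"
  let ?Y = "\<lambda>X::nat \<Rightarrow> real. of_bool (X j < X i) :: real"
  have [measurable]: "(\<lambda>X. dev k l (X k)) \<in> borel_measurable clocks" if "k \<in> {1..n}" for k l
    using that by measurable
  have [measurable]: "rem i j \<in> borel_measurable clocks"
    using ij by measurable
  have [measurable]: "?Y \<in> borel_measurable clocks"
    using ij by measurable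
  have int: "integrable clocks (\<lambda>X. dev i j (X i))" "integrable clocks (\<lambda>X. dev j i (X j))"
    by (rule integrable_bounded[OF _ dev_bound]; use ij in measurable)+
  have int2: "integrable clocks (\<lambda>X. (dev i j (X i))\<^sup>2)" "integrable clocks (\<lambda>X. (dev j i (X j))\<^sup>2)"
    "integrable clocks (\<lambda>X. dev i j (X i) * rem i j X)" "integrable clocks (\<lambda>X. dev j i (X j) * rem i j X)"
    "integrable clocks (\<lambda>X. dev i j (X i) * dev j i (X j))" "integrable clocks (\<lambda>X. (rem i j X)\<^sup>2)"
    unfolding power2_eq_square
    by (rule integrable_bounded_mult[OF _ _ dev_bound dev_bound] integrable_bounded_mult[OF _ _ dev_bound rem_bound]
        integrable_bounded_mult[OF _ _ rem_bound rem_bound]; use ij in measurable)+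
  have intY: "integrable clocks ?Y"
    by (rule integrable_bounded[of _ 1]) auto
  have Y_eq: "?Y X - ?p = rem i j X - dev i j (X i) + dev j i (X j)" for X
    by (simp add: rem_def)
  have dev0: "(\<integral>X. dev i j (X i) \<partial>clocks) = 0" "(\<integral>X. dev j i (X j) \<partial>clocks) = 0"
    using ij by (simp_all add: integral_coordinate integral_dev)
  have "(\<integral>X. ?Y X \<partial>clocks) = (\<integral>X. ?p + rem i j X - dev i j (X i) + dev j i (X j) \<partial>clocks)"
    by (intro Bochner_Integration.integral_cong refl) (use Y_eq in \<open>simp add: algebra_simps\<close>)
  also have "\<dots> = ?p"
    using int integrable_rem[OF assms] by (simp add: integral_rem[OF assms] dev0 P.prob_space)
  finally have EY: "(\<integral>X. ?Y X \<partial>clocks) = ?p" .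
  have "(\<integral>X. (?Y X - ?p)\<^sup>2 \<partial>clocks) = (\<integral>X. ?Y X * (1 - 2 * ?p) + ?p\<^sup>2 \<partial>clocks)"
    by (intro Bochner_Integration.integral_cong refl) (simp add: power2_eq_square algebra_simps)
  also have "\<dots> = ?p * (1 - 2 * ?p) + ?p\<^sup>2"
    using intY by (simp add: EY P.prob_space)
  also have "\<dots> = \<theta> i * \<theta> j / (\<theta> i + \<theta> j)\<^sup>2"
  proof -
    have "1 - ?p = \<theta> i / (\<theta> i + \<theta> j)"
      using weight_pos[of i] weight_pos[of j] by (simp add: field_simps)
    moreover have "?p * (1 - 2 * ?p) + ?p\<^sup>2 = ?p * (1 - ?p)"
      by (simp only: power2_eq_square right_diff_distrib mult_2 distrib_left mult_1_right)
    ultimately show ?thesis by (simp add: power2_eq_square)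
  qed
  finally have 1: "(\<integral>X. (?Y X - ?p)\<^sup>2 \<partial>clocks) = \<theta> i * \<theta> j / (\<theta> i + \<theta> j)\<^sup>2" .
  have "(\<integral>X. (?Y X - ?p)\<^sup>2 \<partial>clocks) = (\<integral>X. (rem i j X)\<^sup>2 + (dev i j (X i))\<^sup>2 + (dev j i (X j))\<^sup>2
      - 2 * (dev i j (X i) * rem i j X) + 2 * (dev j i (X j) * rem i j X) - 2 * (dev i j (X i) * dev j i (X j)) \<partial>clocks)"
    unfolding Y_eq by (intro Bochner_Integration.integral_cong refl) (simp add: power2_eq_square algebra_simps)
  also have "\<dots> = (\<integral>X. (rem i j X)\<^sup>2 \<partial>clocks) + (\<integral>X. (dev i j (X i))\<^sup>2 \<partial>clocks) + (\<integral>X. (dev j i (X j))\<^sup>2 \<partial>clocks)"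
    using int2 ij by (simp add: dev_rem_orthogonal dev_orthogonal)
  also have "(\<integral>X. (dev i j (X i))\<^sup>2 \<partial>clocks) = dev_cov i j j"
    using integral_coordinate[OF ij(1), of "\<lambda>x. (dev i j x)\<^sup>2"] by (simp add: power2_eq_square integral_dev_mult)
  also have "(\<integral>X. (dev j i (X j))\<^sup>2 \<partial>clocks) = dev_cov j i i"
    using integral_coordinate[OF ij(2), of "\<lambda>x. (dev j i x)\<^sup>2"] by (simp add: power2_eq_square integral_dev_mult)
  finally show ?thesis using 1 by simp
qed

lemma integral_remainder_square:
  "(\<integral>X. (remainder X)\<^sup>2 \<partial>clocks) =
    (\<Sum>i=1..n. \<Sum>j\<in>{i<..n}. \<theta> i * \<theta> j / (\<theta> i + \<theta> j)\<^sup>2 - dev_cov i j j - dev_cov j i i)"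
proof -
  let ?r = "\<lambda>q. rem (fst q) (snd q)"
  have int: "integrable clocks (\<lambda>X. ?r q X * ?r q' X)" if "q \<in> pairs" "q' \<in> pairs" for q q'
  proof -
    have "fst q \<in> {1..n}" "snd q \<in> {1..n}" "fst q' \<in> {1..n}" "snd q' \<in> {1..n}"
      using that by (auto simp: pairs_def)
    then show ?thesis
      by (intro integrable_bounded_mult[OF _ _ rem_bound rem_bound] rem_measurable)
  qed
  have zero: "(\<integral>X. ?r q X * ?r q' X \<partial>clocks) = 0" if "q \<in> pairs" "q' \<in> pairs" "q' \<noteq> q" for q q'
    using that by (intro rem_orthogonal) (auto simp: pairs_def prod_eq_iff)
  have "(\<integral>X. (remainder X)\<^sup>2 \<partial>clocks) = (\<integral>X. (\<Sum>q\<in>pairs. \<Sum>q'\<in>pairs. ?r q X * ?r q' X) \<partial>clocks)"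
    unfolding remainder_eq_sum_pairs power2_eq_square sum_product ..
  also have "\<dots> = (\<Sum>q\<in>pairs. \<Sum>q'\<in>pairs. \<integral>X. ?r q X * ?r q' X \<partial>clocks)"
    using int by (simp add: Bochner_Integration.integral_sum)
  also have "\<dots> = (\<Sum>q\<in>pairs. \<integral>X. ?r q X * ?r q X \<partial>clocks)"
  proof (rule sum.cong[OF refl])
    fix q assume q: "q \<in> pairs"
    have "(\<Sum>q'\<in>pairs. \<integral>X. ?r q X * ?r q' X \<partial>clocks) = (\<Sum>q'\<in>{q}. \<integral>X. ?r q X * ?r q' X \<partial>clocks)"
      by (rule sum.mono_neutral_right) (use q zero in auto)
    then show "(\<Sum>q'\<in>pairs. \<integral>X. ?r q X * ?r q' X \<partial>clocks) = (\<integral>X. ?r q X * ?r q X \<partial>clocks)" by simp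
  qed
  finally show ?thesis
    unfolding sum_pairs using integral_rem_square by (simp add: case_prod_unfold flip: power2_eq_square)
qed

lemma dev_cov_nonneg: "0 \<le> dev_cov i j k"
  unfolding dev_cov_def using weight_pos[of i] weight_pos[of j] weight_pos[of k] by simp

text \<open>
  Orthogonality makes this quadratic in \<open>n\<close>, whereas the variance of the projection can be of order
  \<open>n\<^sup>3\<close>.
\<close>

lemma integral_remainder_square_le: "(\<integral>X. (remainder X)\<^sup>2 \<partial>clocks) \<le> (real n)\<^sup>2"
proof -
  have "\<theta> i * \<theta> j / (\<theta> i + \<theta> j)\<^sup>2 - dev_cov i j j - dev_cov j i i \<le> 1" for i j
  proof -
    have "\<theta> i * \<theta> j / (\<theta> i + \<theta> j)\<^sup>2 = \<theta> i / (\<theta> i + \<theta> j) * (\<theta> j / (\<theta> j + \<theta> i))"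
      by (simp add: power2_eq_square add.commute)
    also have "\<dots> \<le> 1" by (intro mult_le_one ratio_bounds)
    finally show ?thesis using dev_cov_nonneg[of i j j] dev_cov_nonneg[of j i i] by simp
  qed
  then have "(\<integral>X. (remainder X)\<^sup>2 \<partial>clocks) \<le> of_nat (card pairs) * 1"
    unfolding integral_remainder_square sum_pairs by (intro sum_bounded_above) auto
  also have "\<dots> \<le> real (n * n)" using card_pairs_le by (simp only: mult_1_right of_nat_le_iff)
  finally show ?thesis by (simp add: power2_eq_square)
qed

lemma variance_split:
  "P.variance (clock_inversions n) = (\<integral>X. (projection X)\<^sup>2 \<partial>clocks) + (\<integral>X. (remainder X)\<^sup>2 \<partial>clocks)"
proof -
  have "P.variance (clock_inversions n) =
      (\<integral>X. (projection X)\<^sup>2 + (remainder X)\<^sup>2 + 2 * (projection X * remainder X) \<partial>clocks)"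
    unfolding integral_clock_inversions
    by (intro Bochner_Integration.integral_cong refl)
       (simp add: clock_inversions_decomposition power2_eq_square algebra_simps)
  then show ?thesis
    using integrable_square_mult by (simp add: integral_projection_remainder)
qed

text \<open>
  The squares of the linear parts cancel between projection and remainder, which leaves the
  variances of the indicators and the covariances over pairs with a common clock.
\<close>

lemma variance_clock_inversions:
  "P.variance (clock_inversions n) =
    (\<Sum>i=1..n. \<Sum>j\<in>{i<..n}. \<theta> i * \<theta> j / (\<theta> i + \<theta> j)^2)
    + (\<Sum>i=1..n. \<Sum>j\<in>{i<..n}. \<Sum>k\<in>{j<..n}.
         4 * \<theta> i * (\<theta> j)^2 * \<theta> k /
         ((\<theta> i + \<theta> j + \<theta> k) * (\<theta> i + \<theta> j) * (\<theta> i + \<theta> k) * (\<theta> j + \<theta> k)))"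
proof -
  let ?F = "\<lambda>i j k. order_sign i j * order_sign i k * dev_cov i j k"
  have "(\<Sum>i=1..n. \<Sum>j=1..n. \<Sum>k=1..n. ?F i j k) =
      (\<Sum>i=1..n. \<Sum>j\<in>{i<..n}. ?F i j j + ?F j i i) +
      2 * (\<Sum>i=1..n. \<Sum>j\<in>{i<..n}. \<Sum>k\<in>{j<..n}. ?F i j k + ?F j i k + ?F k i j)"
    by (rule sum_cube_symmetric) (auto simp: order_sign_def dev_cov_def mult_ac add_ac)
  also have "(\<Sum>i=1..n. \<Sum>j\<in>{i<..n}. ?F i j j + ?F j i i) = (\<Sum>i=1..n. \<Sum>j\<in>{i<..n}. dev_cov i j j + dev_cov j i i)"
    by (intro sum.cong refl) (auto simp: order_sign_def)
  also have "2 * (\<Sum>i=1..n. \<Sum>j\<in>{i<..n}. \<Sum>k\<in>{j<..n}. ?F i j k + ?F j i k + ?F k i j) =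
      (\<Sum>i=1..n. \<Sum>j\<in>{i<..n}. \<Sum>k\<in>{j<..n}. 4 * \<theta> i * (\<theta> j)^2 * \<theta> k /
         ((\<theta> i + \<theta> j + \<theta> k) * (\<theta> i + \<theta> j) * (\<theta> i + \<theta> k) * (\<theta> j + \<theta> k)))"
    unfolding sum_distrib_left
  proof (intro sum.cong refl)
    fix i j k assume "j \<in> {i<..n}" "k \<in> {j<..n}"
    then have "2 * (?F i j k + ?F j i k + ?F k i j) = 2 * (dev_cov i j k - dev_cov j i k + dev_cov k i j)"
      by (simp add: order_sign_def)
    also have "\<dots> = 4 * \<theta> i * (\<theta> j)^2 * \<theta> k /
         ((\<theta> i + \<theta> j + \<theta> k) * (\<theta> i + \<theta> j) * (\<theta> i + \<theta> k) * (\<theta> j + \<theta> k))"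
    proof -
      \<comment> \<open>In the application \<open>a\<close>, \<open>b\<close>, \<open>c\<close> are the pairwise sums of \<open>x\<close>, \<open>y\<close>, \<open>z\<close>, and \<open>s\<close> is their total.\<close>
      have alg: "2 * (x * y * z / (s * a * b) - x * y * z / (s * a * c) + x * y * z / (s * b * c))
          = 4 * x * y^2 * z / (s * a * b * c)"
        if "c - b + a = 2 * y" "s \<noteq> 0" "a \<noteq> 0" "b \<noteq> 0" "c \<noteq> 0" for x y z s a b c :: real
      proof -
        have "x * y * z / (s * a * b) = x * y * z * c / (s * a * b * c)"
          "x * y * z / (s * a * c) = x * y * z * b / (s * a * b * c)"
          "x * y * z / (s * b * c) = x * y * z * a / (s * a * b * c)"
          using that by simp_all
        moreover have "2 * (A / D - B / D + C / D) = 2 * (A - B + C) / D" for A B C D :: real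
          by (simp add: add_divide_distrib diff_divide_distrib)
        ultimately have "2 * (x * y * z / (s * a * b) - x * y * z / (s * a * c) + x * y * z / (s * b * c))
            = 2 * (x * y * z * c - x * y * z * b + x * y * z * a) / (s * a * b * c)"
          by (simp only:)
        also have "\<dots> = 2 * (x * y * z) * (c - b + a) / (s * a * b * c)"
          by (simp only: algebra_simps)
        also have "\<dots> = 4 * x * y^2 * z / (s * a * b * c)"
          unfolding that(1) by (simp add: power2_eq_square mult_ac)
        finally show ?thesis .
      qed
      have pos: "0 < \<theta> i" "0 < \<theta> j" "0 < \<theta> k" by (auto simp: weight_pos)
      have "dev_cov i j k = \<theta> i * \<theta> j * \<theta> k / ((\<theta> i + \<theta> j + \<theta> k) * (\<theta> i + \<theta> j) * (\<theta> i + \<theta> k))"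
        "dev_cov j i k = \<theta> i * \<theta> j * \<theta> k / ((\<theta> i + \<theta> j + \<theta> k) * (\<theta> i + \<theta> j) * (\<theta> j + \<theta> k))"
        "dev_cov k i j = \<theta> i * \<theta> j * \<theta> k / ((\<theta> i + \<theta> j + \<theta> k) * (\<theta> i + \<theta> k) * (\<theta> j + \<theta> k))"
        by (simp_all add: dev_cov_def add_ac mult_ac)
      then show ?thesis
        using alg[of "\<theta> j + \<theta> k" "\<theta> i + \<theta> k" "\<theta> i + \<theta> j" "\<theta> j" "\<theta> i + \<theta> j + \<theta> k" "\<theta> i" "\<theta> k"] pos
        by simp
    qed
    finally show "2 * (?F i j k + ?F j i k + ?F k i j) = 4 * \<theta> i * (\<theta> j)^2 * \<theta> k /
         ((\<theta> i + \<theta> j + \<theta> k) * (\<theta> i + \<theta> j) * (\<theta> i + \<theta> k) * (\<theta> j + \<theta> k))" .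
  qed
  finally show ?thesis
    unfolding variance_split integral_projection_square integral_remainder_square
    by (simp add: sum.distrib sum_subtractf)
qed

end

section \<open>Normal approximation\<close>

text \<open>
  Off an event that Chebyshev's inequality controls, the perturbation shifts the argument by at most \<open>\<epsilon>\<close>, and
  \<open>\<Phi>\<close> is Lipschitz with constant \<open>1\<close>.
\<close>

lemma (in prob_space) normal_approximation_perturb:
  fixes S R :: "'a \<Rightarrow> real"
  assumes [measurable]: "S \<in> borel_measurable M" "R \<in> borel_measurable M"
    and S: "\<And>z. \<bar>\<P>(\<omega> in M. S \<omega> \<le> z) - Phi z\<bar> \<le> b"
    and R: "integrable M (\<lambda>\<omega>. (R \<omega>)\<^sup>2)" "expectation (\<lambda>\<omega>. (R \<omega>)\<^sup>2) \<le> r"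
    and \<epsilon>: "0 < \<epsilon>"
  shows "\<bar>\<P>(\<omega> in M. S \<omega> + R \<omega> \<le> t) - Phi t\<bar> \<le> b + \<epsilon> + r / \<epsilon>\<^sup>2"
proof -
  have tail: "\<P>(\<omega> in M. \<epsilon> \<le> \<bar>R \<omega>\<bar>) \<le> r / \<epsilon>\<^sup>2"
  proof -
    have "\<P>(\<omega> in M. \<epsilon> \<le> \<bar>R \<omega>\<bar>) \<le> expectation (\<lambda>\<omega>. (R \<omega>)\<^sup>2) / \<epsilon>\<^sup>2"
      by (rule second_moment_method) (use R \<epsilon> in auto)
    also have "\<dots> \<le> r / \<epsilon>\<^sup>2" using R(2) by (intro divide_right_mono) auto
    finally show ?thesis .
  qed
  have "\<P>(\<omega> in M. S \<omega> + R \<omega> \<le> t) \<le> \<P>(\<omega> in M. S \<omega> \<le> t + \<epsilon>) + \<P>(\<omega> in M. \<epsilon> \<le> \<bar>R \<omega>\<bar>)"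
    by (intro order_trans[OF finite_measure_mono measure_Un_le]) auto
  moreover have "\<P>(\<omega> in M. S \<omega> \<le> t - \<epsilon>) \<le> \<P>(\<omega> in M. S \<omega> + R \<omega> \<le> t) + \<P>(\<omega> in M. \<epsilon> \<le> \<bar>R \<omega>\<bar>)"
    by (intro order_trans[OF finite_measure_mono measure_Un_le]) auto
  moreover have "Phi (t + \<epsilon>) \<le> Phi t + \<epsilon>" "Phi t \<le> Phi (t - \<epsilon>) + \<epsilon>"
    using Phi_Lipschitz[of t "t + \<epsilon>"] Phi_Lipschitz[of "t - \<epsilon>" t] \<epsilon> by auto
  ultimately show ?thesis
    using S[of "t + \<epsilon>"] S[of "t - \<epsilon>"] tail unfolding abs_le_iff by linarith
qed

context luce_clocks
begin

text \<open>
  With \<open>q = n / \<sigma>\<close>, the scaled projection has summands bounded by \<open>q\<close> and variance at least \<open>1 - q\<^sup>2\<close>, and the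
  scaled remainder has second moment at most \<open>q\<^sup>2\<close>. The choice \<open>\<epsilon> = q\<^bsup>2/3\<^esup>\<close> equates \<open>\<epsilon>\<close> with
  \<open>q\<^sup>2 / \<epsilon>\<^sup>2\<close>. The hypothesis \<open>\<sigma> \<ge> 2 n\<close> ensures \<open>q \<le> 1 / 2\<close>.
\<close>

lemma clock_inversions_normal_approximation:
  assumes \<sigma>: "2 * real n \<le> \<sigma>" "\<sigma>\<^sup>2 = P.variance (clock_inversions n)"
  shows "\<bar>\<P>(X in clocks. (clock_inversions n X - mean_inversions) / \<sigma> \<le> t) - Phi t\<bar>
    \<le> 30 * (real n / \<sigma>) powr (2 / 3)"
proof -
  have n: "1 \<le> real n" using n_pos by simp
  then have \<sigma>_pos: "0 < \<sigma>" using \<sigma>(1) by linarith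
  define q where "q = real n / \<sigma>"
  have q: "0 < q" "q \<le> 1 / 2" "q \<le> 1" using \<sigma>(1) \<sigma>_pos n by (auto simp: q_def field_simps)
  define \<epsilon> where "\<epsilon> = q powr (2 / 3)"
  have \<epsilon>: "0 < \<epsilon>" "q \<le> \<epsilon>" "q\<^sup>2 / \<epsilon>\<^sup>2 = \<epsilon>"
  proof -
    show "0 < \<epsilon>" using q by (simp add: \<epsilon>_def)
    show "q \<le> \<epsilon>" unfolding \<epsilon>_def using powr_mono'[of "2 / 3" 1 q] q by simp
    have "q\<^sup>2 = q powr (2 / 3) * (q powr (2 / 3))\<^sup>2"
      using q by (simp add: power2_eq_square flip: powr_add)
    then show "q\<^sup>2 / \<epsilon>\<^sup>2 = \<epsilon>" using \<open>0 < \<epsilon>\<close> by (simp add: \<epsilon>_def)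
  qed
  have var: "\<sigma>\<^sup>2 = (\<integral>X. (projection X)\<^sup>2 \<partial>clocks) + (\<integral>X. (remainder X)\<^sup>2 \<partial>clocks)"
    using \<sigma>(2) variance_split by simp
  define r where "r = (\<integral>X. (remainder X / \<sigma>)\<^sup>2 \<partial>clocks)"
  have r: "0 \<le> r" "r \<le> q\<^sup>2"
  proof -
    show "0 \<le> r" unfolding r_def by simp
    have "r = (\<integral>X. (remainder X)\<^sup>2 \<partial>clocks) / \<sigma>\<^sup>2"
      unfolding r_def power_divide by simp
    then show "r \<le> q\<^sup>2"
      using integral_remainder_square_le by (simp add: q_def power_divide divide_right_mono)
  qed
  define S where "S X = (\<Sum>i\<in>{1..n}. 1 / \<sigma> * hajek i (X i))" for X
  have S_eq: "S X = projection X / \<sigma>" for X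
    by (simp add: S_def projection_def sum_divide_distrib)
  have v: "(\<integral>X. (S X)\<^sup>2 \<partial>clocks) = 1 - r"
  proof -
    have "(\<integral>X. (S X)\<^sup>2 \<partial>clocks) = (\<integral>X. (projection X)\<^sup>2 \<partial>clocks) / \<sigma>\<^sup>2"
      unfolding S_eq power_divide by simp
    moreover have "r = (\<integral>X. (remainder X)\<^sup>2 \<partial>clocks) / \<sigma>\<^sup>2"
      unfolding r_def power_divide by simp
    ultimately have "(\<integral>X. (S X)\<^sup>2 \<partial>clocks) + r = \<sigma>\<^sup>2 / \<sigma>\<^sup>2"
      unfolding var by (simp only: add_divide_distrib)
    then show ?thesis using \<sigma>_pos by simp
  qed
  have "q\<^sup>2 \<le> q * (1 / 2)" unfolding power2_eq_square using q by (intro mult_left_mono) auto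
  then have r_half: "r \<le> 1 / 2" "r \<le> q" using r q by auto
  have BE: "\<bar>\<P>(X in clocks. S X \<le> z) - Phi z\<bar> \<le> 26 * q + 2 * (1 - (\<integral>X. (S X)\<^sup>2 \<partial>clocks))" for z
    unfolding S_def
  proof (rule P.Berry_Esseen_bounded[where \<xi> = "\<lambda>i X. 1 / \<sigma> * hajek i (X i)"])
    show "P.indep_vars (\<lambda>_. borel) (\<lambda>i X. 1 / \<sigma> * hajek i (X i)) {1..n}"
      by (rule indep_vars_hajek)
    show "\<bar>1 / \<sigma> * hajek i (X i)\<bar> \<le> q" for i X
      using hajek_bound[of i "X i"] \<sigma>_pos by (simp add: abs_mult q_def divide_right_mono)
    show "(\<integral>X. 1 / \<sigma> * hajek i (X i) \<partial>clocks) = 0" if "i \<in> {1..n}" for i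
      using integral_hajek[OF that] by simp
    show "1 / 2 \<le> (\<integral>X. (\<Sum>i\<in>{1..n}. 1 / \<sigma> * hajek i (X i))\<^sup>2 \<partial>clocks)"
      "(\<integral>X. (\<Sum>i\<in>{1..n}. 1 / \<sigma> * hajek i (X i))\<^sup>2 \<partial>clocks) \<le> 1"
      using v r r_half unfolding S_def by auto
  qed (use q in auto)
  have "\<bar>\<P>(X in clocks. S X + remainder X / \<sigma> \<le> t) - Phi t\<bar> \<le> 28 * q + \<epsilon> + q\<^sup>2 / \<epsilon>\<^sup>2"
  proof (rule P.normal_approximation_perturb)
    show "\<bar>\<P>(X in clocks. S X \<le> z) - Phi z\<bar> \<le> 28 * q" for z
      using BE[of z] r_half unfolding v by simp
    show "integrable clocks (\<lambda>X. (remainder X / \<sigma>)\<^sup>2)"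
      unfolding power_divide using integrable_square_mult by simp
    show "(\<integral>X. (remainder X / \<sigma>)\<^sup>2 \<partial>clocks) \<le> q\<^sup>2"
      using r(2) unfolding r_def .
  qed (use \<epsilon> in \<open>auto simp: S_eq[abs_def]\<close>)
  moreover have "S X + remainder X / \<sigma> = (clock_inversions n X - mean_inversions) / \<sigma>" for X
    unfolding S_eq clock_inversions_decomposition by (simp add: add_divide_distrib)
  ultimately show ?thesis
    using \<epsilon> by (simp add: \<epsilon>_def q_def)
qed

end

lemma luce_distributed_cong:
  assumes "\<And>i. i \<in> {1..n} \<Longrightarrow> \<theta> i = \<theta>' i"
  shows "luce_distributed n \<theta> P \<longleftrightarrow> luce_distributed n \<theta>' P"
proof -
  have "luce_weight n (\<lambda>i. \<theta> (inv \<sigma> i)) = luce_weight n (\<lambda>i. \<theta>' (inv \<sigma> i))" if "\<sigma> permutes {1..n}" for \<sigma>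
  proof -
    have eq: "\<theta> (inv \<sigma> i) = \<theta>' (inv \<sigma> i)" if "i \<in> {1..n}" for i
      using assms permutes_in_image[OF permutes_inv[OF \<open>\<sigma> permutes {1..n}\<close>]] that by blast
    have "(\<Sum>j\<in>{1..<i}. \<theta> (inv \<sigma> j)) = (\<Sum>j\<in>{1..<i}. \<theta>' (inv \<sigma> j))" if "i \<in> {1..n}" for i
      by (intro sum.cong refl eq) (use that in auto)
    moreover have "(\<Sum>j=1..n. \<theta> (inv \<sigma> j)) = (\<Sum>j=1..n. \<theta>' (inv \<sigma> j))"
      by (intro sum.cong refl eq)
    ultimately show ?thesis
      unfolding luce_weight_def by (intro prod.cong refl) (simp add: eq)
  qed
  then show ?thesis unfolding luce_distributed_def by auto
qed

theorem theorem4p1: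
  "\<exists>C::real. \<forall>(n::nat) (\<theta>::nat \<Rightarrow> real) (P::(nat \<Rightarrow> nat) pmf).
     n \<ge> 1 \<longrightarrow> (\<forall>i\<in>{1..n}. \<theta> i > 0) \<longrightarrow> luce_distributed n \<theta> P \<longrightarrow>
     (let X = (\<lambda>\<sigma>. real (occ21 n \<sigma>));
          E = measure_pmf.expectation P X;
          V = measure_pmf.variance P X;
          a = max 0 (sqrt V - real n)
      in E = (\<Sum>i=1..n. \<Sum>j\<in>{i<..n}. \<theta> j / (\<theta> i + \<theta> j)) \<and>
         V = (\<Sum>i=1..n. \<Sum>j\<in>{i<..n}. \<theta> i * \<theta> j / (\<theta> i + \<theta> j)^2)
           + (\<Sum>i=1..n. \<Sum>j\<in>{i<..n}. \<Sum>k\<in>{j<..n}.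
                4 * \<theta> i * (\<theta> j)^2 * \<theta> k /
                ((\<theta> i + \<theta> j + \<theta> k) * (\<theta> i + \<theta> j) * (\<theta> i + \<theta> k) * (\<theta> j + \<theta> k))) \<and>
         (a > 0 \<longrightarrow>
           (SUP t::real. \<bar>measure_pmf.prob P {\<sigma>. (X \<sigma> - E) / sqrt V \<le> t}
                          - cdf std_normal_distribution t\<bar>)
           \<le> C * real n ^ 4 / a ^ 3 + C * real n / a
             + C * real n powr (2/3) / a powr (2/3)))"
proof (intro exI[of _ 30] allI impI)
  fix n :: nat and \<theta> :: "nat \<Rightarrow> real" and P :: "(nat \<Rightarrow> nat) pmf"
  assume n: "n \<ge> 1" and pos: "\<forall>i\<in>{1..n}. \<theta> i > 0" and luce: "luce_distributed n \<theta> P"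
  \<comment> \<open>The clocks need positive rates at all indices; the Luce law depends on those in \<open>{1..n}\<close>.\<close>
  define \<theta>' where "\<theta>' i = (if i \<in> {1..n} then \<theta> i else 1)" for i
  have \<theta>': "\<theta>' i = \<theta> i" if "i \<in> {1..n}" for i using that by (simp only: \<theta>'_def if_True)
  interpret L: luce_clocks n \<theta>'
    by unfold_locales (use n pos in \<open>auto simp: \<theta>'_def\<close>)
  let ?X = "\<lambda>\<sigma>. real (occ21 n \<sigma>)"
  have law: "distr (measure_pmf P) borel ?X = distr L.clocks borel (clock_inversions n)"
    using luce luce_distributed_cong[of n \<theta> \<theta>'] by (intro luce_inversions_law L.weight_pos) (simp add: \<theta>')
  have N [measurable]: "clock_inversions n \<in> borel_measurable L.clocks"
    by (rule clock_inversions_measurable)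
  have transfer: "measure_pmf.expectation P (\<lambda>\<sigma>. g (?X \<sigma>)) = (\<integral>Y. g (clock_inversions n Y) \<partial>L.clocks)"
    if g: "g \<in> borel_measurable borel" for g :: "real \<Rightarrow> real"
  proof -
    have "measure_pmf.expectation P (\<lambda>\<sigma>. g (?X \<sigma>)) = (\<integral>x. g x \<partial>distr (measure_pmf P) borel ?X)"
      by (rule integral_distr[symmetric]) (use g in auto)
    also have "\<dots> = (\<integral>Y. g (clock_inversions n Y) \<partial>L.clocks)"
      unfolding law by (rule integral_distr[OF N g])
    finally show ?thesis .
  qed
  define E where "E = measure_pmf.expectation P ?X"
  define V where "V = measure_pmf.variance P ?X"
  define a where "a = max 0 (sqrt V - real n)"
  have E: "E = L.mean_inversions"
    unfolding E_def using transfer[of "\<lambda>x. x"] L.integral_clock_inversions by simp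
  have V: "V = L.P.variance (clock_inversions n)"
    unfolding V_def using transfer[of "\<lambda>x. (x - E)\<^sup>2"] by (simp add: E_def[symmetric] E L.integral_clock_inversions)
  have prob: "measure_pmf.prob P {\<sigma>. (?X \<sigma> - E) / sqrt V \<le> t} =
      \<P>(Y in L.clocks. (clock_inversions n Y - L.mean_inversions) / sqrt V \<le> t)" for t
  proof -
    let ?B = "{x. (x - E) / sqrt V \<le> t}"
    have B: "?B \<in> sets borel" by measurable
    have "measure_pmf.prob P (?X -` ?B \<inter> space (measure_pmf P)) = measure (distr (measure_pmf P) borel ?X) ?B"
      by (rule measure_distr[symmetric]) (use B in auto)
    also have "\<dots> = measure L.clocks (clock_inversions n -` ?B \<inter> space L.clocks)"
      unfolding law by (rule measure_distr[OF N B])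
    finally show ?thesis
      by (simp add: vimage_def E Int_def conj_commute)
  qed
  have E_formula: "E = (\<Sum>i=1..n. \<Sum>j\<in>{i<..n}. \<theta> j / (\<theta> i + \<theta> j))"
    unfolding E L.mean_inversions_def by (intro sum.cong refl) (auto simp: \<theta>'_def)
  have V_formula: "V = (\<Sum>i=1..n. \<Sum>j\<in>{i<..n}. \<theta> i * \<theta> j / (\<theta> i + \<theta> j)^2)
           + (\<Sum>i=1..n. \<Sum>j\<in>{i<..n}. \<Sum>k\<in>{j<..n}.
                4 * \<theta> i * (\<theta> j)^2 * \<theta> k /
                ((\<theta> i + \<theta> j + \<theta> k) * (\<theta> i + \<theta> j) * (\<theta> i + \<theta> k) * (\<theta> j + \<theta> k)))"
    unfolding V L.variance_clock_inversions
    by (intro arg_cong2[of _ _ _ _ "(+)"] sum.cong refl) (auto simp: \<theta>'_def)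
  have bound: "(SUP t::real. \<bar>measure_pmf.prob P {\<sigma>. (?X \<sigma> - E) / sqrt V \<le> t} - Phi t\<bar>)
      \<le> 30 * real n ^ 4 / a ^ 3 + 30 * real n / a + 30 * real n powr (2/3) / a powr (2/3)" if a: "a > 0"
  proof (rule cSUP_least)
    fix t :: real
    have le_\<sigma>: "a \<le> sqrt V" and a_eq: "a = sqrt V - real n" using a by (auto simp: a_def)
    have V_pos: "0 < sqrt V" using a le_\<sigma> by linarith
    let ?T1 = "30 * real n ^ 4 / a ^ 3" and ?T2 = "30 * real n / a" and ?T3 = "30 * real n powr (2/3) / a powr (2/3)"
    have nonneg: "0 \<le> ?T1" "0 \<le> ?T2" "0 \<le> ?T3" using a by auto
    show "\<bar>measure_pmf.prob P {\<sigma>. (?X \<sigma> - E) / sqrt V \<le> t} - Phi t\<bar> \<le> ?T1 + ?T2 + ?T3"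
    proof (cases "2 * real n \<le> sqrt V")
      case True
      have "V \<ge> 0" unfolding V by (rule L.P.variance_positive)
      then have "(sqrt V)\<^sup>2 = L.P.variance (clock_inversions n)" using V by simp
      then have "\<bar>measure_pmf.prob P {\<sigma>. (?X \<sigma> - E) / sqrt V \<le> t} - Phi t\<bar> \<le> 30 * (real n / sqrt V) powr (2 / 3)"
        unfolding prob by (rule L.clock_inversions_normal_approximation[OF True])
      also have "\<dots> \<le> 30 * (real n / a) powr (2 / 3)"
        using a le_\<sigma> V_pos by (intro mult_left_mono powr_mono2 divide_left_mono mult_pos_pos) auto
      also have "\<dots> = ?T3"
        using a by (simp add: powr_divide)
      finally show ?thesis using nonneg by linarith
    next
      case False
      \<comment> \<open>The second term of the bound alone already exceeds any difference of probabilities.\<close>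
      then have "a \<le> real n" unfolding a_eq by simp
      then have "30 \<le> ?T2" using a by (simp add: pos_le_divide_eq)
      moreover have "\<bar>measure_pmf.prob P {\<sigma>. (?X \<sigma> - E) / sqrt V \<le> t} - Phi t\<bar> \<le> 1"
        using Phi_nonneg[of t] Phi_le_1[of t] measure_pmf.prob_le_1[of P "{\<sigma>. (?X \<sigma> - E) / sqrt V \<le> t}"]
          measure_nonneg[of P "{\<sigma>. (?X \<sigma> - E) / sqrt V \<le> t}"] by linarith
      ultimately show ?thesis using nonneg by linarith
    qed
  qed simp
  show "let X = (\<lambda>\<sigma>. real (occ21 n \<sigma>));
          E = measure_pmf.expectation P X;
          V = measure_pmf.variance P X;
          a = max 0 (sqrt V - real n)
      in E = (\<Sum>i=1..n. \<Sum>j\<in>{i<..n}. \<theta> j / (\<theta> i + \<theta> j)) \<and>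
         V = (\<Sum>i=1..n. \<Sum>j\<in>{i<..n}. \<theta> i * \<theta> j / (\<theta> i + \<theta> j)^2)
           + (\<Sum>i=1..n. \<Sum>j\<in>{i<..n}. \<Sum>k\<in>{j<..n}.
                4 * \<theta> i * (\<theta> j)^2 * \<theta> k /
                ((\<theta> i + \<theta> j + \<theta> k) * (\<theta> i + \<theta> j) * (\<theta> i + \<theta> k) * (\<theta> j + \<theta> k))) \<and>
         (a > 0 \<longrightarrow>
           (SUP t::real. \<bar>measure_pmf.prob P {\<sigma>. (X \<sigma> - E) / sqrt V \<le> t}
                          - cdf std_normal_distribution t\<bar>)
           \<le> 30 * real n ^ 4 / a ^ 3 + 30 * real n / a
             + 30 * real n powr (2/3) / a powr (2/3))"
    unfolding Let_def V_def[symmetric]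
    unfolding E_def[symmetric] a_def[symmetric]
    using E_formula V_formula bound by blast
qed

end
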